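(* Let $L:\mathcal{B}\to\mathcal{A}$ be a functor with a right adjoint $R:\mathcal{A}\to\mathcal{B}$ (with unit $\eta$ and counit $\epsilon$), and let $(G,\Delta,\varepsilon)$ be any comonad on $\mathcal{A}$. Consider a functor $K_\varphi:\mathcal{B}\to\mathcal{A}_G$ such that $UK_\varphi=L$, with corresponding morphism of comonads $\varphi:LR\to G$, and let $\alpha=R\varphi\circ\eta R:R\to RG$. Suppose that for every $G$-coalgebra $(X,x)$ the equalizer of $\alpha_X,Rx:RX\to RGX$ exists in $\mathcal{B}$. Then $K_\varphi$ is an equivalence of categories between $\mathcal{B}$ and $\mathcal{A}_G$ if and only if $L$ preserves the equalizers of the form $$D_\varphi X\xrightarrow{\;eq_X\;}RX\;\overset{\alpha_X}{\underset{Rx}{\rightrightarrows}}\;RGX\qquad((X,x)\text{ a }G\text{-coalgebra}),$$ $L$ reflects isomorphisms, and $\varphi$ is an isomorphism of comonads.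
   Context: A comonad $(G,\Delta,\varepsilon)$ on $\mathcal{A}$ is a functor $G:\mathcal{A}\to\mathcal{A}$ with natural transformations $\Delta:G\to G^2$, $\varepsilon:G\to id_{\mathcal{A}}$ such that $G\Delta\circ\Delta=\Delta G\circ\Delta$ and $\varepsilon G\circ\Delta=id_G=G\varepsilon\circ\Delta$. The category $\mathcal{A}_G$ of $G$-coalgebras has as objects the pairs $(X,x)$ with $x:X\to GX$ in $\mathcal{A}$ such that $Gx\circ x=\Delta_X\circ x$ and $\varepsilon_X\circ x=id_X$; morphisms $(X,x)\to(X',x')$ are the $f:X\to X'$ in $\mathcal{A}$ with $Gf\circ x=x'\circ f$. $U:\mathcal{A}_G\to\mathcal{A}$ is the forgetful functor. $LR$ is regarded as the comonad $(LR,\delta,\epsilon)$ with $\delta=L\eta R$. A morphism of comonads $\varphi:LR\to G$ is a natural transformation with $\Delta\circ\varphi=\varphi^2\circ\delta$ and $\varepsilon\circ\varphi=\epsilon$, where $\varphi^2_X=\varphi_{GX}\circ LR\varphi_X$. Functors $K:\mathcal{B}\to\mathcal{A}_G$ with $UK=L$ correspond bijectively to morphisms of comonads $\varphi:LR\to G$: the functor $K_\varphi$ corresponding to $\varphi$ is $K_\varphi Y=(LY,\varphi_{LY}\circ L\eta_Y)$ on objects and $K_\varphi f=Lf$ on morphisms. $D_\varphi X$ denotes the equalizer object displayed in the claim. *)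

theory Defs
  imports Main
begin

section \<open>Categories, functors, natural transformations\<close>

text \<open>Composition is a total operation on the type of arrows, constrained only on composable
  arrows of the category; it is written in the usual order, \<open>g\<close> after \<open>f\<close>.
  Likewise functors and transformations are constrained only on the objects and arrows of
  their source category.\<close>

record ('o, 'm) category =
  Obj :: "'o set"
  Arr :: "'m set"
  Dom :: "'m \<Rightarrow> 'o"
  Cod :: "'m \<Rightarrow> 'o"
  Ident :: "'o \<Rightarrow> 'm"
  Comp :: "'m \<Rightarrow> 'm \<Rightarrow> 'm" (infixr "\<cdot>\<index>" 70)

definition Hom :: "('o, 'm) category \<Rightarrow> 'o \<Rightarrow> 'o \<Rightarrow> 'm set" where
  "Hom C X Y = {f \<in> Arr C. Dom C f = X \<and> Cod C f = Y}"

locale category =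
  fixes C :: "('o, 'm) category"
  assumes Dom_closed: "f \<in> Arr C \<Longrightarrow> Dom C f \<in> Obj C"
    and Cod_closed: "f \<in> Arr C \<Longrightarrow> Cod C f \<in> Obj C"
    and Ident_Hom: "X \<in> Obj C \<Longrightarrow> Ident C X \<in> Hom C X X"
    and Comp_Hom: "\<lbrakk>f \<in> Hom C X Y; g \<in> Hom C Y Z\<rbrakk> \<Longrightarrow> g \<cdot>\<^bsub>C\<^esub> f \<in> Hom C X Z"
    and Comp_Ident_right: "f \<in> Hom C X Y \<Longrightarrow> f \<cdot>\<^bsub>C\<^esub> Ident C X = f"
    and Comp_Ident_left: "f \<in> Hom C X Y \<Longrightarrow> Ident C Y \<cdot>\<^bsub>C\<^esub> f = f"
    and Comp_assoc: "\<lbrakk>f \<in> Hom C W X; g \<in> Hom C X Y; h \<in> Hom C Y Z\<rbrakk>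
      \<Longrightarrow> (h \<cdot>\<^bsub>C\<^esub> g) \<cdot>\<^bsub>C\<^esub> f = h \<cdot>\<^bsub>C\<^esub> (g \<cdot>\<^bsub>C\<^esub> f)"

definition is_iso :: "('o, 'm) category \<Rightarrow> 'm \<Rightarrow> bool" where
  "is_iso C f \<longleftrightarrow> f \<in> Arr C \<and>
    (\<exists>g \<in> Hom C (Cod C f) (Dom C f).
      g \<cdot>\<^bsub>C\<^esub> f = Ident C (Dom C f) \<and> f \<cdot>\<^bsub>C\<^esub> g = Ident C (Cod C f))"

record ('o, 'm, 'p, 'n) ftor =
  ob :: "'o \<Rightarrow> 'p"
  mor :: "'m \<Rightarrow> 'n"

definition id_ftor :: "('o, 'm, 'o, 'm) ftor" where
  "id_ftor = \<lparr>ob = (\<lambda>X. X), mor = (\<lambda>f. f)\<rparr>"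

definition comp_ftor :: "('p, 'n, 'q, 'k) ftor \<Rightarrow> ('o, 'm, 'p, 'n) ftor \<Rightarrow> ('o, 'm, 'q, 'k) ftor"
    (infixr "\<odot>" 75) where
  "G \<odot> F = \<lparr>ob = (\<lambda>X. ob G (ob F X)), mor = (\<lambda>f. mor G (mor F f))\<rparr>"

locale is_functor = src: category C + tgt: category D
  for C :: "('o, 'm) category" and D :: "('p, 'n) category" +
  fixes F :: "('o, 'm, 'p, 'n) ftor"
  assumes ob_closed: "X \<in> Obj C \<Longrightarrow> ob F X \<in> Obj D"
    and mor_Hom: "f \<in> Hom C X Y \<Longrightarrow> mor F f \<in> Hom D (ob F X) (ob F Y)"
    and mor_Ident: "X \<in> Obj C \<Longrightarrow> mor F (Ident C X) = Ident D (ob F X)"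
    and mor_Comp: "\<lbrakk>f \<in> Hom C X Y; g \<in> Hom C Y Z\<rbrakk>
      \<Longrightarrow> mor F (g \<cdot>\<^bsub>C\<^esub> f) = mor F g \<cdot>\<^bsub>D\<^esub> mor F f"

definition ftor_eq :: "('o, 'm) category \<Rightarrow> ('o, 'm, 'p, 'n) ftor \<Rightarrow> ('o, 'm, 'p, 'n) ftor \<Rightarrow> bool"
  where
  "ftor_eq C F G \<longleftrightarrow> (\<forall>X \<in> Obj C. ob F X = ob G X) \<and> (\<forall>f \<in> Arr C. mor F f = mor G f)"

locale nat_trans = src: is_functor C D F + tgt: is_functor C D G
  for C :: "('o, 'm) category" and D :: "('p, 'n) category"
    and F :: "('o, 'm, 'p, 'n) ftor" and G :: "('o, 'm, 'p, 'n) ftor" +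
  fixes \<tau> :: "'o \<Rightarrow> 'n"
  assumes component_Hom: "X \<in> Obj C \<Longrightarrow> \<tau> X \<in> Hom D (ob F X) (ob G X)"
    and naturality: "f \<in> Hom C X Y \<Longrightarrow> mor G f \<cdot>\<^bsub>D\<^esub> \<tau> X = \<tau> Y \<cdot>\<^bsub>D\<^esub> mor F f"

locale nat_iso = nat_trans +
  assumes component_iso: "X \<in> Obj C \<Longrightarrow> is_iso D (\<tau> X)"

definition is_equivalence ::
    "('o, 'm) category \<Rightarrow> ('p, 'n) category \<Rightarrow> ('o, 'm, 'p, 'n) ftor \<Rightarrow> bool" where
  "is_equivalence C D F \<longleftrightarrow> is_functor C D F \<and>
    (\<exists>H \<mu> \<nu>. is_functor D C H \<and> nat_iso C C id_ftor (H \<odot> F) \<mu> \<and> nat_iso D D (F \<odot> H) id_ftor \<nu>)"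

definition reflects_isos ::
    "('o, 'm) category \<Rightarrow> ('p, 'n) category \<Rightarrow> ('o, 'm, 'p, 'n) ftor \<Rightarrow> bool" where
  "reflects_isos C D F \<longleftrightarrow> (\<forall>f \<in> Arr C. is_iso D (mor F f) \<longrightarrow> is_iso C f)"


section \<open>Equalizers\<close>

definition is_equalizer :: "('o, 'm) category \<Rightarrow> 'm \<Rightarrow> 'm \<Rightarrow> 'o \<Rightarrow> 'm \<Rightarrow> bool" where
  "is_equalizer C f g E e \<longleftrightarrow>
    f \<in> Arr C \<and> g \<in> Hom C (Dom C f) (Cod C f) \<and>
    E \<in> Obj C \<and> e \<in> Hom C E (Dom C f) \<and> f \<cdot>\<^bsub>C\<^esub> e = g \<cdot>\<^bsub>C\<^esub> e \<and>
    (\<forall>Z \<in> Obj C. \<forall>h \<in> Hom C Z (Dom C f).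
      f \<cdot>\<^bsub>C\<^esub> h = g \<cdot>\<^bsub>C\<^esub> h \<longrightarrow> (\<exists>!k. k \<in> Hom C Z E \<and> e \<cdot>\<^bsub>C\<^esub> k = h))"

definition preserves_equalizer ::
    "('o, 'm) category \<Rightarrow> ('p, 'n) category \<Rightarrow> ('o, 'm, 'p, 'n) ftor \<Rightarrow> 'm \<Rightarrow> 'm \<Rightarrow> bool" where
  "preserves_equalizer C D F f g \<longleftrightarrow>
    (\<forall>E e. is_equalizer C f g E e \<longrightarrow> is_equalizer D (mor F f) (mor F g) (ob F E) (mor F e))"


section \<open>Adjunctions and comonads\<close>

locale adjunction =
  unit: nat_trans B B id_ftor "R \<odot> L" \<eta> + counit: nat_trans A A "L \<odot> R" id_ftor \<epsilon> +
  left: is_functor B A L + right: is_functor A B R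
  for B :: "('p, 'n) category" and A :: "('o, 'm) category"
    and L :: "('p, 'n, 'o, 'm) ftor" and R :: "('o, 'm, 'p, 'n) ftor"
    and \<eta> :: "'p \<Rightarrow> 'n" and \<epsilon> :: "'o \<Rightarrow> 'm" +
  assumes triangle_left: "Y \<in> Obj B \<Longrightarrow> \<epsilon> (ob L Y) \<cdot>\<^bsub>A\<^esub> mor L (\<eta> Y) = Ident A (ob L Y)"
    and triangle_right: "X \<in> Obj A \<Longrightarrow> mor R (\<epsilon> X) \<cdot>\<^bsub>B\<^esub> \<eta> (ob R X) = Ident B (ob R X)"

locale comonad =
  comult: nat_trans A A G "G \<odot> G" \<Delta> + counit: nat_trans A A G id_ftor \<epsilon>
  for A :: "('o, 'm) category" and G :: "('o, 'm, 'o, 'm) ftor"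
    and \<Delta> :: "'o \<Rightarrow> 'm" and \<epsilon> :: "'o \<Rightarrow> 'm" +
  assumes coassoc: "X \<in> Obj A \<Longrightarrow> mor G (\<Delta> X) \<cdot>\<^bsub>A\<^esub> \<Delta> X = \<Delta> (ob G X) \<cdot>\<^bsub>A\<^esub> \<Delta> X"
    and counit_left: "X \<in> Obj A \<Longrightarrow> \<epsilon> (ob G X) \<cdot>\<^bsub>A\<^esub> \<Delta> X = Ident A (ob G X)"
    and counit_right: "X \<in> Obj A \<Longrightarrow> mor G (\<epsilon> X) \<cdot>\<^bsub>A\<^esub> \<Delta> X = Ident A (ob G X)"

definition adj_comult ::
    "('p, 'n, 'o, 'm) ftor \<Rightarrow> ('o, 'm, 'p, 'n) ftor \<Rightarrow> ('p \<Rightarrow> 'n) \<Rightarrow> 'o \<Rightarrow> 'm" where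
  "adj_comult L R \<eta> X = mor L (\<eta> (ob R X))"

locale comonad_morphism =
  src: comonad A G \<Delta> \<epsilon> + tgt: comonad A G' \<Delta>' \<epsilon>' + nat_trans A A G G' \<phi>
  for A :: "('o, 'm) category"
    and G :: "('o, 'm, 'o, 'm) ftor" and \<Delta> :: "'o \<Rightarrow> 'm" and \<epsilon> :: "'o \<Rightarrow> 'm"
    and G' :: "('o, 'm, 'o, 'm) ftor" and \<Delta>' :: "'o \<Rightarrow> 'm" and \<epsilon>' :: "'o \<Rightarrow> 'm"
    and \<phi> :: "'o \<Rightarrow> 'm" +
  assumes comult_compat: "X \<in> Obj A
      \<Longrightarrow> \<Delta>' X \<cdot>\<^bsub>A\<^esub> \<phi> X = (\<phi> (ob G' X) \<cdot>\<^bsub>A\<^esub> mor G (\<phi> X)) \<cdot>\<^bsub>A\<^esub> \<Delta> X"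
    and counit_compat: "X \<in> Obj A \<Longrightarrow> \<epsilon>' X \<cdot>\<^bsub>A\<^esub> \<phi> X = \<epsilon> X"

definition is_comonad_iso ::
    "('o, 'm) category \<Rightarrow> ('o, 'm, 'o, 'm) ftor \<Rightarrow> ('o \<Rightarrow> 'm) \<Rightarrow> ('o \<Rightarrow> 'm)
      \<Rightarrow> ('o, 'm, 'o, 'm) ftor \<Rightarrow> ('o \<Rightarrow> 'm) \<Rightarrow> ('o \<Rightarrow> 'm) \<Rightarrow> ('o \<Rightarrow> 'm) \<Rightarrow> bool" where
  "is_comonad_iso A G \<Delta> \<epsilon> G' \<Delta>' \<epsilon>' \<phi> \<longleftrightarrow>
    comonad_morphism A G \<Delta> \<epsilon> G' \<Delta>' \<epsilon>' \<phi> \<and>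
    (\<exists>\<psi>. comonad_morphism A G' \<Delta>' \<epsilon>' G \<Delta> \<epsilon> \<psi> \<and>
      (\<forall>X \<in> Obj A. \<psi> X \<cdot>\<^bsub>A\<^esub> \<phi> X = Ident A (ob G X) \<and> \<phi> X \<cdot>\<^bsub>A\<^esub> \<psi> X = Ident A (ob G' X)))"


section \<open>Coalgebras over a comonad\<close>

definition is_coalgebra ::
    "('o, 'm) category \<Rightarrow> ('o, 'm, 'o, 'm) ftor \<Rightarrow> ('o \<Rightarrow> 'm) \<Rightarrow> ('o \<Rightarrow> 'm) \<Rightarrow> 'o \<Rightarrow> 'm \<Rightarrow> bool"
  where
  "is_coalgebra A G \<Delta> \<epsilon> X x \<longleftrightarrow> X \<in> Obj A \<and> x \<in> Hom A X (ob G X) \<and>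
    mor G x \<cdot>\<^bsub>A\<^esub> x = \<Delta> X \<cdot>\<^bsub>A\<^esub> x \<and> \<epsilon> X \<cdot>\<^bsub>A\<^esub> x = Ident A X"

text \<open>An arrow of the category of coalgebras is a triple consisting of its source coalgebra, the
  underlying arrow and its target coalgebra, since the underlying arrow alone does not determine
  the coalgebra structures on its source and target.\<close>

definition coalgebras ::
    "('o, 'm) category \<Rightarrow> ('o, 'm, 'o, 'm) ftor \<Rightarrow> ('o \<Rightarrow> 'm) \<Rightarrow> ('o \<Rightarrow> 'm)
      \<Rightarrow> ('o \<times> 'm, ('o \<times> 'm) \<times> 'm \<times> ('o \<times> 'm)) category" where
  "coalgebras A G \<Delta> \<epsilon> = \<lparr>
    Obj = {(X, x). is_coalgebra A G \<Delta> \<epsilon> X x},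
    Arr = {((X, x), f, (X', x')). is_coalgebra A G \<Delta> \<epsilon> X x \<and> is_coalgebra A G \<Delta> \<epsilon> X' x' \<and>
      f \<in> Hom A X X' \<and> mor G f \<cdot>\<^bsub>A\<^esub> x = x' \<cdot>\<^bsub>A\<^esub> f},
    Dom = (\<lambda>(S, f, T). S),
    Cod = (\<lambda>(S, f, T). T),
    Ident = (\<lambda>(X, x). ((X, x), Ident A X, (X, x))),
    Comp = (\<lambda>(S', g, T') (S, f, T). (S, g \<cdot>\<^bsub>A\<^esub> f, T'))\<rparr>"

definition forgetful :: "('o \<times> 'm, ('o \<times> 'm) \<times> 'm \<times> ('o \<times> 'm), 'o, 'm) ftor" where
  "forgetful = \<lparr>ob = (\<lambda>(X, x). X), mor = (\<lambda>(S, f, T). f)\<rparr>"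

definition comparison_ftor ::
    "('p, 'n) category \<Rightarrow> ('o, 'm) category \<Rightarrow> ('p, 'n, 'o, 'm) ftor \<Rightarrow> ('p \<Rightarrow> 'n) \<Rightarrow> ('o \<Rightarrow> 'm)
      \<Rightarrow> ('p, 'n, 'o \<times> 'm, ('o \<times> 'm) \<times> 'm \<times> ('o \<times> 'm)) ftor" where
  "comparison_ftor B A L \<eta> \<phi> =
    (let K = (\<lambda>Y. (ob L Y, \<phi> (ob L Y) \<cdot>\<^bsub>A\<^esub> mor L (\<eta> Y)))
     in \<lparr>ob = K, mor = (\<lambda>f. (K (Dom B f), mor L f, K (Cod B f)))\<rparr>)"

definition comparison_\<alpha> ::
    "('p, 'n) category \<Rightarrow> ('o, 'm, 'p, 'n) ftor \<Rightarrow> ('p \<Rightarrow> 'n) \<Rightarrow> ('o \<Rightarrow> 'm) \<Rightarrow> 'o \<Rightarrow> 'n" where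
  "comparison_\<alpha> B R \<eta> \<phi> X = mor R (\<phi> X) \<cdot>\<^bsub>B\<^esub> \<eta> (ob R X)"

end

theory Submission
  imports Defs
begin

text \<open>
  Write \<open>\<kappa>\<^sub>Y = \<phi>\<^sub>L\<^sub>Y \<circ> L\<eta>\<^sub>Y\<close> for the coaction that \<open>K\<close> puts on \<open>L Y\<close>. Transposition along the adjunction
  turns an arrow \<open>f : L Y \<rightarrow> X\<close> into \<open>g = R f \<circ> \<eta>\<^sub>Y : Y \<rightarrow> R X\<close>, and \<open>f\<close> is a coalgebra map
  \<open>K Y \<rightarrow> (X, x)\<close> exactly when \<open>g\<close> equalizes \<open>\<alpha>\<^sub>X\<close> and \<open>R x\<close>: the transposes of \<open>G f \<circ> \<kappa>\<^sub>Y\<close> and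
  \<open>x \<circ> f\<close> are \<open>\<alpha>\<^sub>X \<circ> g\<close> and \<open>R x \<circ> g\<close> (\<open>coalgebra_map_iff\<close>). Hence an equalizer \<open>e : E \<rightarrow> R X\<close> of
  \<open>\<alpha>\<^sub>X\<close> and \<open>R x\<close> gives a couniversal arrow \<open>p = \<epsilon>\<^sub>X \<circ> L e : K E \<rightarrow> (X, x)\<close> from \<open>K\<close> to \<open>(X, x)\<close>
  (\<open>equalizer_couniversal\<close>). Similarly \<open>\<phi>\<^sub>X : K (R X) \<rightarrow> (G X, \<Delta>\<^sub>X)\<close> is couniversal
  (\<open>\<phi>_couniversal\<close>), because the cofree coalgebra functor and \<open>R\<close> are right adjoint to the
  forgetful functor and to its composite \<open>L\<close> with \<open>K\<close>.

  If \<open>K\<close> is an equivalence, couniversal arrows from \<open>K\<close> are isomorphisms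
  (\<open>is_functor.couniversal_iso\<close>), so every \<open>\<phi>\<^sub>X\<close> and every \<open>p\<close> is invertible. Through \<open>\<phi>\<close>, the image
  under \<open>L\<close> of the fork at \<open>(X, x)\<close> is compared with the fork \<open>X \<rightarrow> G X \<rightrightarrows> G G X\<close> of \<open>x\<close>, \<open>\<Delta>\<^sub>X\<close> and
  \<open>G x\<close>, which is split by the counit of \<open>G\<close> and is therefore an equalizer. Since
  \<open>\<phi>\<^sub>X \<circ> L e = x \<circ> p\<close>, invertibility of \<open>\<phi>\<^sub>X\<close> and \<open>p\<close> makes \<open>L e\<close> an equalizer as well
  (\<open>L_equalizer_if_iso\<close>). Reflection of isomorphisms holds because \<open>K\<close> and the forgetful functor
  both reflect them.

  Conversely, if \<open>\<phi>\<close> is invertible and \<open>L e\<close> is an equalizer, then \<open>p\<close> is the comparison between two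
  equalizers of the same pair and hence invertible (\<open>iso_if_L_equalizer\<close>), so \<open>K\<close> is essentially
  surjective. For \<open>(X, x) = K Z\<close> the identity factors as \<open>p \<circ> L u\<close> with \<open>u : Z \<rightarrow> E\<close>; thus \<open>L u\<close>
  is inverse to \<open>p\<close>, and \<open>u\<close> is invertible because \<open>L\<close> reflects isomorphisms. So coalgebra maps
  \<open>K Y \<rightarrow> K Z\<close> correspond to arrows \<open>Y \<rightarrow> Z\<close>, which says that \<open>K\<close> is fully faithful.
\<close>

section \<open>Composable arrows and isomorphisms\<close>

lemma Hom_iff: "f \<in> Hom C X Y \<longleftrightarrow> f \<in> Arr C \<and> Dom C f = X \<and> Cod C f = Y"
  by (simp add: Hom_def)

context category
begin

lemma Comp_arr:
  assumes "f \<in> Arr C" "g \<in> Arr C" "Cod C f = Dom C g"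
  shows "g \<cdot>\<^bsub>C\<^esub> f \<in> Arr C" "Dom C (g \<cdot>\<^bsub>C\<^esub> f) = Dom C f" "Cod C (g \<cdot>\<^bsub>C\<^esub> f) = Cod C g"
  using Comp_Hom[of f "Dom C f" "Cod C f" g "Cod C g"] assms by (simp_all add: Hom_iff)

lemma Ident_arr:
  assumes "X \<in> Obj C"
  shows "Ident C X \<in> Arr C" "Dom C (Ident C X) = X" "Cod C (Ident C X) = X"
  using Ident_Hom[OF assms] by (simp_all add: Hom_iff)

lemma Comp_id_right: "f \<in> Arr C \<Longrightarrow> Dom C f = X \<Longrightarrow> f \<cdot>\<^bsub>C\<^esub> Ident C X = f"
  using Comp_Ident_right[of f X "Cod C f"] by (simp add: Hom_iff)

lemma Comp_id_left: "f \<in> Arr C \<Longrightarrow> Cod C f = Y \<Longrightarrow> Ident C Y \<cdot>\<^bsub>C\<^esub> f = f"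
  using Comp_Ident_left[of f "Dom C f" Y] by (simp add: Hom_iff)

lemma Comp_assoc_arr:
  assumes "f \<in> Arr C" "g \<in> Arr C" "h \<in> Arr C" "Cod C f = Dom C g" "Cod C g = Dom C h"
  shows "(h \<cdot>\<^bsub>C\<^esub> g) \<cdot>\<^bsub>C\<^esub> f = h \<cdot>\<^bsub>C\<^esub> (g \<cdot>\<^bsub>C\<^esub> f)"
  using Comp_assoc[of f "Dom C f" "Dom C g" g "Dom C h" h "Cod C h"] assms by (simp add: Hom_iff)

lemmas arr_simps = Dom_closed Cod_closed Comp_arr Ident_arr Comp_id_right Comp_id_left Comp_assoc_arr

text \<open>In a composite bracketed to the right, an equation between composites of two arrows can only
  be used as a rewrite rule in this extended form.\<close>

lemma Comp_extend:
  assumes "g \<cdot>\<^bsub>C\<^esub> f = g' \<cdot>\<^bsub>C\<^esub> f'"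
    and "f \<in> Arr C" "g \<in> Arr C" "Cod C f = Dom C g"
    and "f' \<in> Arr C" "g' \<in> Arr C" "Cod C f' = Dom C g'"
    and "k \<in> Arr C" "Cod C k = Dom C f"
  shows "g \<cdot>\<^bsub>C\<^esub> (f \<cdot>\<^bsub>C\<^esub> k) = g' \<cdot>\<^bsub>C\<^esub> (f' \<cdot>\<^bsub>C\<^esub> k)"
proof -
  have "Dom C f' = Dom C f"
    using assms Comp_arr(2) by metis
  then show ?thesis
    using assms Comp_assoc_arr by metis
qed

lemma Comp_cancel:
  assumes "g \<cdot>\<^bsub>C\<^esub> f = Ident C X"
    and "f \<in> Arr C" "g \<in> Arr C" "Dom C f = X" "Cod C f = Dom C g" "k \<in> Arr C" "Cod C k = X"
  shows "g \<cdot>\<^bsub>C\<^esub> (f \<cdot>\<^bsub>C\<^esub> k) = k"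
  using assms Comp_assoc_arr[of k f g] by (simp add: Comp_id_left)

lemma is_isoI:
  assumes "f \<in> Hom C X Y" "g \<in> Hom C Y X" "g \<cdot>\<^bsub>C\<^esub> f = Ident C X" "f \<cdot>\<^bsub>C\<^esub> g = Ident C Y"
  shows "is_iso C f"
  using assms unfolding is_iso_def by (auto simp: Hom_iff)

lemma is_isoE:
  assumes "is_iso C f" "f \<in> Hom C X Y"
  obtains g where "g \<in> Arr C" "Dom C g = Y" "Cod C g = X"
    "g \<cdot>\<^bsub>C\<^esub> f = Ident C X" "f \<cdot>\<^bsub>C\<^esub> g = Ident C Y"
  using assms unfolding is_iso_def by (auto simp: Hom_iff)

end

context is_functor
begin

lemma mor_arr:
  assumes "f \<in> Arr C"
  shows "mor F f \<in> Arr D" "Dom D (mor F f) = ob F (Dom C f)" "Cod D (mor F f) = ob F (Cod C f)"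
  using mor_Hom[of f "Dom C f" "Cod C f"] assms by (simp_all add: Hom_iff)

lemma mor_Comp_arr:
  "f \<in> Arr C \<Longrightarrow> g \<in> Arr C \<Longrightarrow> Cod C f = Dom C g \<Longrightarrow> mor F (g \<cdot>\<^bsub>C\<^esub> f) = mor F g \<cdot>\<^bsub>D\<^esub> mor F f"
  using mor_Comp[of f "Dom C f" "Dom C g" g "Cod C g"] by (simp add: Hom_iff)

lemmas functor_simps = ob_closed mor_arr mor_Ident mor_Comp_arr

end

context nat_trans
begin

lemma component_arr:
  assumes "X \<in> Obj C"
  shows "\<tau> X \<in> Arr D" "Dom D (\<tau> X) = ob F X" "Cod D (\<tau> X) = ob G X"
  using component_Hom[OF assms] by (simp_all add: Hom_iff)

lemma naturality_arr:
  "f \<in> Arr C \<Longrightarrow> Dom C f = X \<Longrightarrow> Cod C f = Y \<Longrightarrow> mor G f \<cdot>\<^bsub>D\<^esub> \<tau> X = \<tau> Y \<cdot>\<^bsub>D\<^esub> mor F f"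
  using naturality[of f X Y] by (simp add: Hom_iff)

end

section \<open>Equivalences as fully faithful, essentially surjective functors\<close>

definition fully_faithful ::
    "('o, 'm) category \<Rightarrow> ('p, 'n) category \<Rightarrow> ('o, 'm, 'p, 'n) ftor \<Rightarrow> bool" where
  "fully_faithful C D F \<longleftrightarrow>
    (\<forall>X \<in> Obj C. \<forall>Y \<in> Obj C. bij_betw (mor F) (Hom C X Y) (Hom D (ob F X) (ob F Y)))"

definition essentially_surjective ::
    "('o, 'm) category \<Rightarrow> ('p, 'n) category \<Rightarrow> ('o, 'm, 'p, 'n) ftor \<Rightarrow> bool" where
  "essentially_surjective C D F \<longleftrightarrow>
    (\<forall>T \<in> Obj D. \<exists>X \<in> Obj C. \<exists>f \<in> Hom D (ob F X) T. is_iso D f)"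

lemma fully_faithful_inj:
  assumes "fully_faithful C D F" "f \<in> Hom C X Y" "g \<in> Hom C X Y" "mor F f = mor F g"
    and "X \<in> Obj C" "Y \<in> Obj C"
  shows "f = g"
  using assms unfolding fully_faithful_def bij_betw_def inj_on_def by blast

lemma fully_faithful_lift:
  assumes "fully_faithful C D F" "t \<in> Hom D (ob F X) (ob F Y)" "X \<in> Obj C" "Y \<in> Obj C"
  obtains g where "g \<in> Hom C X Y" "mor F g = t"
proof -
  have "t \<in> mor F ` Hom C X Y"
    using assms unfolding fully_faithful_def bij_betw_def by blast
  then show ?thesis
    using that by blast
qed

lemma (in is_functor) fully_faithful_reflects_isos:
  assumes ff: "fully_faithful C D F"
  shows "reflects_isos C D F"
  unfolding reflects_isos_def
proof (intro ballI impI)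
  fix f assume f: "f \<in> Arr C" and "is_iso D (mor F f)"
  then obtain t where t: "t \<in> Hom D (ob F (Cod C f)) (ob F (Dom C f))"
    and ti: "t \<cdot>\<^bsub>D\<^esub> mor F f = Ident D (ob F (Dom C f))" "mor F f \<cdot>\<^bsub>D\<^esub> t = Ident D (ob F (Cod C f))"
    unfolding is_iso_def by (auto simp: mor_arr)
  have obs: "Dom C f \<in> Obj C" "Cod C f \<in> Obj C"
    using f by (simp_all add: src.arr_simps)
  obtain g where g: "g \<in> Hom C (Cod C f) (Dom C f)" and gt: "mor F g = t"
    using fully_faithful_lift[OF ff t] obs by blast
  have "mor F (g \<cdot>\<^bsub>C\<^esub> f) = mor F (Ident C (Dom C f))"
    "mor F (f \<cdot>\<^bsub>C\<^esub> g) = mor F (Ident C (Cod C f))"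
    using f g gt ti obs by (simp_all add: Hom_iff functor_simps)
  then have "g \<cdot>\<^bsub>C\<^esub> f = Ident C (Dom C f)" "f \<cdot>\<^bsub>C\<^esub> g = Ident C (Cod C f)"
    using f g obs by (auto intro!: fully_faithful_inj[OF ff] simp: Hom_iff src.arr_simps)
  then show "is_iso C f"
    using f g by (auto simp: is_iso_def)
qed

lemma equivalence_imp_ff_es:
  assumes "is_equivalence C D F"
  shows "fully_faithful C D F" "essentially_surjective C D F"
proof -
  obtain H \<mu> \<nu> where "is_functor C D F" "is_functor D C H"
    and \<mu>: "nat_iso C C id_ftor (H \<odot> F) \<mu>" and \<nu>: "nat_iso D D (F \<odot> H) id_ftor \<nu>"
    using assms unfolding is_equivalence_def by blast
  interpret F: is_functor C D F by fact
  interpret H: is_functor D C H by fact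
  interpret \<mu>: nat_iso C C id_ftor "H \<odot> F" \<mu> by fact
  interpret \<nu>: nat_iso D D "F \<odot> H" id_ftor \<nu> by fact
  note c = F.src.arr_simps F.tgt.arr_simps F.functor_simps H.functor_simps
    \<mu>.component_arr \<nu>.component_arr id_ftor_def comp_ftor_def
  \<comment> \<open>For the preimage \<open>g\<close> of \<open>t\<close> constructed below, naturality of \<open>\<mu>\<close> gives only \<open>H (F g) = H t\<close>;
    faithfulness of \<open>H\<close> is what turns this into fullness of \<open>F\<close>.\<close>
  have H_inj: "s = t"
    if s: "s \<in> Hom D X Y" and t: "t \<in> Hom D X Y" and eq: "mor H s = mor H t" for s t X Y
  proof -
    have X: "X \<in> Obj D" and Y: "Y \<in> Obj D"
      using s F.tgt.arr_simps by (auto simp: Hom_iff)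
    have "s \<cdot>\<^bsub>D\<^esub> \<nu> X = t \<cdot>\<^bsub>D\<^esub> \<nu> X"
      using \<nu>.naturality[OF s] \<nu>.naturality[OF t] eq by (simp add: id_ftor_def comp_ftor_def)
    moreover obtain n where n: "n \<in> Arr D" "Dom D n = X" "Cod D n = ob F (ob H X)"
      "\<nu> X \<cdot>\<^bsub>D\<^esub> n = Ident D X"
      using F.tgt.is_isoE[OF \<nu>.component_iso[OF X] \<nu>.component_Hom[OF X]]
      by (auto simp: comp_ftor_def id_ftor_def)
    moreover have "(r \<cdot>\<^bsub>D\<^esub> \<nu> X) \<cdot>\<^bsub>D\<^esub> n = r" if "r \<in> Hom D X Y" for r
      using that n X by (simp add: c Hom_iff)
    ultimately show ?thesis
      using s t by metis
  qed
  show "fully_faithful C D F"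
    unfolding fully_faithful_def
  proof (intro ballI)
    fix X Y assume X: "X \<in> Obj C" and Y: "Y \<in> Obj C"
    obtain m where m: "m \<in> Arr C" "Dom C m = ob H (ob F Y)" "Cod C m = Y"
      "m \<cdot>\<^bsub>C\<^esub> \<mu> Y = Ident C Y" "\<mu> Y \<cdot>\<^bsub>C\<^esub> m = Ident C (ob H (ob F Y))"
      using F.src.is_isoE[OF \<mu>.component_iso[OF Y] \<mu>.component_Hom[OF Y]]
      by (auto simp: comp_ftor_def id_ftor_def)
    obtain k where k: "k \<in> Arr C" "Dom C k = ob H (ob F X)" "Cod C k = X"
      "\<mu> X \<cdot>\<^bsub>C\<^esub> k = Ident C (ob H (ob F X))"
      using F.src.is_isoE[OF \<mu>.component_iso[OF X] \<mu>.component_Hom[OF X]]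
      by (auto simp: comp_ftor_def id_ftor_def)
    have nat: "mor H (mor F g) \<cdot>\<^bsub>C\<^esub> \<mu> X = \<mu> Y \<cdot>\<^bsub>C\<^esub> g" if "g \<in> Hom C X Y" for g
      using \<mu>.naturality[OF that] by (simp add: comp_ftor_def id_ftor_def)
    have F_inj: "f = g" if f: "f \<in> Hom C X Y" and g: "g \<in> Hom C X Y" and "mor F f = mor F g" for f g
    proof -
      have "\<mu> Y \<cdot>\<^bsub>C\<^esub> f = \<mu> Y \<cdot>\<^bsub>C\<^esub> g"
        using nat[OF f] nat[OF g] that by simp
      then have "m \<cdot>\<^bsub>C\<^esub> (\<mu> Y \<cdot>\<^bsub>C\<^esub> f) = m \<cdot>\<^bsub>C\<^esub> (\<mu> Y \<cdot>\<^bsub>C\<^esub> g)"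
        by simp
      then show ?thesis
        using f g X Y m by (simp add: c Hom_iff F.src.Comp_cancel[OF m(4)])
    qed
    have F_surj: "\<exists>g \<in> Hom C X Y. mor F g = t" if t: "t \<in> Hom D (ob F X) (ob F Y)" for t
    proof -
      define g where "g = m \<cdot>\<^bsub>C\<^esub> (mor H t \<cdot>\<^bsub>C\<^esub> \<mu> X)"
      have g: "g \<in> Hom C X Y"
        using t m X Y by (simp add: g_def c Hom_iff)
      have "\<mu> Y \<cdot>\<^bsub>C\<^esub> g = mor H t \<cdot>\<^bsub>C\<^esub> \<mu> X"
        using t m X Y by (simp add: g_def c Hom_iff F.src.Comp_cancel[OF m(5)])
      then have "(mor H (mor F g) \<cdot>\<^bsub>C\<^esub> \<mu> X) \<cdot>\<^bsub>C\<^esub> k = (mor H t \<cdot>\<^bsub>C\<^esub> \<mu> X) \<cdot>\<^bsub>C\<^esub> k"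
        using nat[OF g] by simp
      then have "mor H (mor F g) = mor H t"
        using k g t X Y by (simp add: c Hom_iff)
      then have "mor F g = t"
        using H_inj[OF F.mor_Hom[OF g] t] by simp
      then show ?thesis
        using g by blast
    qed
    show "bij_betw (mor F) (Hom C X Y) (Hom D (ob F X) (ob F Y))"
      unfolding bij_betw_def inj_on_def using F_inj F_surj F.mor_Hom by blast
  qed
  show "essentially_surjective C D F"
    unfolding essentially_surjective_def
  proof
    fix T assume T: "T \<in> Obj D"
    then show "\<exists>X \<in> Obj C. \<exists>f \<in> Hom D (ob F X) T. is_iso D f"
      using \<nu>.component_iso[OF T] \<nu>.component_Hom[OF T] H.ob_closed[OF T]
      by (auto simp: comp_ftor_def id_ftor_def)
  qed
qed


lemma id_functor: "category C \<Longrightarrow> is_functor C C id_ftor"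
  by (simp add: is_functor_def is_functor_axioms_def id_ftor_def)

lemma comp_functor:
  assumes "is_functor C D F" "is_functor D E G"
  shows "is_functor C E (G \<odot> F)"
proof -
  interpret F: is_functor C D F by fact
  interpret G: is_functor D E G by fact
  show ?thesis
    by unfold_locales
      (auto simp: comp_ftor_def F.ob_closed G.ob_closed F.mor_Ident G.mor_Ident
        F.mor_Comp G.mor_Comp[OF F.mor_Hom F.mor_Hom] intro: F.mor_Hom G.mor_Hom)
qed

text \<open>The quasi-inverse sends \<open>T\<close> to a chosen object whose image is isomorphic to \<open>T\<close>. The chosen
  isomorphism \<open>c T\<close> is couniversal because the functor is fully faithful; the action on arrows, its
  functoriality and both naturality conditions are consequences of this couniversal property.\<close>

lemma ff_es_imp_equivalence:
  assumes "is_functor C D F" and ff: "fully_faithful C D F" and es: "essentially_surjective C D F"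
  shows "is_equivalence C D F"
proof -
  interpret F: is_functor C D F by fact
  note c = F.src.arr_simps F.tgt.arr_simps F.functor_simps id_ftor_def comp_ftor_def
  obtain h c where hc: "\<And>T. T \<in> Obj D \<Longrightarrow> h T \<in> Obj C \<and> c T \<in> Hom D (ob F (h T)) T \<and> is_iso D (c T)"
    using es unfolding essentially_surjective_def by metis
  then have h: "h T \<in> Obj C" and c_hom: "c T \<in> Hom D (ob F (h T)) T" and c_iso: "is_iso D (c T)"
    and c_arr: "c T \<in> Arr D" "Dom D (c T) = ob F (h T)" "Cod D (c T) = T" if "T \<in> Obj D" for T
    using that by (simp_all add: Hom_iff)
  have lift: "\<exists>!g. g \<in> Hom C Z (h T) \<and> c T \<cdot>\<^bsub>D\<^esub> mor F g = s"
    if s: "s \<in> Hom D (ob F Z) T" and Z: "Z \<in> Obj C" and T: "T \<in> Obj D" for s Z T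
  proof -
    obtain d where d: "d \<in> Arr D" "Dom D d = T" "Cod D d = ob F (h T)"
      "d \<cdot>\<^bsub>D\<^esub> c T = Ident D (ob F (h T))" "c T \<cdot>\<^bsub>D\<^esub> d = Ident D T"
      using F.tgt.is_isoE[OF c_iso[OF T] c_hom[OF T]] by blast
    have "d \<cdot>\<^bsub>D\<^esub> s \<in> Hom D (ob F Z) (ob F (h T))"
      using d s by (simp add: Hom_iff c)
    then obtain g where g: "g \<in> Hom C Z (h T)" "mor F g = d \<cdot>\<^bsub>D\<^esub> s"
      using fully_faithful_lift[OF ff _ Z h[OF T]] by blast
    show ?thesis
    proof (rule ex1I[of _ g], intro conjI)
      show "c T \<cdot>\<^bsub>D\<^esub> mor F g = s"
        using g d s T by (simp add: Hom_iff F.tgt.Comp_cancel[OF d(5)] c_arr)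
    next
      fix g' assume g': "g' \<in> Hom C Z (h T) \<and> c T \<cdot>\<^bsub>D\<^esub> mor F g' = s"
      have "mor F g' = d \<cdot>\<^bsub>D\<^esub> (c T \<cdot>\<^bsub>D\<^esub> mor F g')"
        using g' d T F.tgt.Comp_cancel[OF d(4), of "mor F g'"] by (simp add: Hom_iff c_arr F.mor_arr)
      then show "g' = g"
        using g' g fully_faithful_inj[OF ff _ _ _ Z h[OF T]] by simp
    qed (fact g)
  qed
  define lft where "lft Z T s = (THE g. g \<in> Hom C Z (h T) \<and> c T \<cdot>\<^bsub>D\<^esub> mor F g = s)" for Z T s
  have lft: "lft Z T s \<in> Arr C" "Dom C (lft Z T s) = Z" "Cod C (lft Z T s) = h T"
      "c T \<cdot>\<^bsub>D\<^esub> mor F (lft Z T s) = s"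
    if "s \<in> Arr D" "Dom D s = ob F Z" "Cod D s = T" "Z \<in> Obj C" for s Z T
    using theI'[OF lift[of s Z T]] that F.tgt.Cod_closed[of s] by (auto simp: lft_def Hom_iff)
  have uniq: "g = g'"
    if "g \<in> Hom C Z (h T)" "g' \<in> Hom C Z (h T)" "c T \<cdot>\<^bsub>D\<^esub> mor F g = c T \<cdot>\<^bsub>D\<^esub> mor F g'"
      "Z \<in> Obj C" "T \<in> Obj D" for g g' Z T
  proof -
    have "c T \<cdot>\<^bsub>D\<^esub> mor F g' \<in> Hom D (ob F Z) T"
      using that c_hom F.mor_Hom F.tgt.Comp_Hom by blast
    then show ?thesis
      using lift[of "c T \<cdot>\<^bsub>D\<^esub> mor F g'" Z T] that by blast
  qed
  define H where "H = \<lparr>ob = h, mor = (\<lambda>t. lft (h (Dom D t)) (Cod D t) (t \<cdot>\<^bsub>D\<^esub> c (Dom D t)))\<rparr>"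
  define \<mu> where "\<mu> X = lft X (ob F X) (Ident D (ob F X))" for X
  have Ht: "mor H t \<in> Arr C" "Dom C (mor H t) = h (Dom D t)" "Cod C (mor H t) = h (Cod D t)"
    "c (Cod D t) \<cdot>\<^bsub>D\<^esub> mor F (mor H t) = t \<cdot>\<^bsub>D\<^esub> c (Dom D t)" if "t \<in> Arr D" for t
    using lft[of "t \<cdot>\<^bsub>D\<^esub> c (Dom D t)" "h (Dom D t)" "Cod D t"] that
    by (simp_all add: H_def c_arr h c)
  have H: "is_functor D C H"
  proof unfold_locales
    fix X assume X: "X \<in> Obj D"
    show "ob H X \<in> Obj C"
      using h[OF X] by (simp add: H_def)
    show "mor H (Ident D X) = Ident C (ob H X)"
      using X Ht(1-3)[of "Ident D X"] Ht(4)[of "Ident D X"]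
      by (auto intro!: uniq[of _ "h X" X] simp: Hom_iff H_def h c_arr c)
  next
    fix f X Y assume f: "f \<in> Hom D X Y"
    show "mor H f \<in> Hom C (ob H X) (ob H Y)"
      using f Ht[of f] by (simp add: Hom_iff H_def)
    fix g Z assume g: "g \<in> Hom D Y Z"
    have obs: "X \<in> Obj D" "Y \<in> Obj D" "Z \<in> Obj D"
      using f g F.tgt.Dom_closed F.tgt.Cod_closed by (auto simp: Hom_iff)
    have "c Z \<cdot>\<^bsub>D\<^esub> mor F (mor H g \<cdot>\<^bsub>C\<^esub> mor H f) = (c Z \<cdot>\<^bsub>D\<^esub> mor F (mor H g)) \<cdot>\<^bsub>D\<^esub> mor F (mor H f)"
      using f g obs Ht(1-3)[of f] Ht(1-3)[of g] by (simp add: Hom_iff c c_arr)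
    also have "\<dots> = (g \<cdot>\<^bsub>D\<^esub> c Y) \<cdot>\<^bsub>D\<^esub> mor F (mor H f)"
      using g Ht(4)[of g] by (simp add: Hom_iff)
    also have "\<dots> = g \<cdot>\<^bsub>D\<^esub> (f \<cdot>\<^bsub>D\<^esub> c X)"
      using f g obs Ht[of f] by (simp add: Hom_iff c c_arr)
    also have "\<dots> = c Z \<cdot>\<^bsub>D\<^esub> mor F (mor H (g \<cdot>\<^bsub>D\<^esub> f))"
      using f g obs Ht(4)[of "g \<cdot>\<^bsub>D\<^esub> f"] by (simp add: Hom_iff c c_arr)
    finally show "mor H (g \<cdot>\<^bsub>D\<^esub> f) = mor H g \<cdot>\<^bsub>C\<^esub> mor H f"
      using f g obs Ht(1-3)[of f] Ht(1-3)[of g] Ht(1-3)[of "g \<cdot>\<^bsub>D\<^esub> f"]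
      by (intro uniq[of _ "h X" Z]) (simp_all add: Hom_iff c h)
  qed
  interpret H: is_functor D C H by fact
  have \<mu>: "\<mu> X \<in> Arr C" "Dom C (\<mu> X) = X" "Cod C (\<mu> X) = h (ob F X)"
    "c (ob F X) \<cdot>\<^bsub>D\<^esub> mor F (\<mu> X) = Ident D (ob F X)" if X: "X \<in> Obj C" for X
    unfolding \<mu>_def using lft[of "Ident D (ob F X)" X "ob F X"] X by (simp_all add: c)
  interpret I: is_functor C C id_ftor
    by (rule id_functor) unfold_locales
  interpret HF: is_functor C C "H \<odot> F"
    by (rule comp_functor) unfold_locales
  interpret J: is_functor D D id_ftor
    by (rule id_functor) unfold_locales
  interpret FH: is_functor D D "F \<odot> H"
    by (rule comp_functor) unfold_locales
  have "nat_iso C C id_ftor (H \<odot> F) \<mu>"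
  proof unfold_locales
    fix X assume X: "X \<in> Obj C"
    show "\<mu> X \<in> Hom C (ob id_ftor X) (ob (H \<odot> F) X)"
      using \<mu>[OF X] by (simp add: Hom_iff id_ftor_def comp_ftor_def H_def)
    have FX: "ob F X \<in> Obj D"
      using X by (rule F.ob_closed)
    obtain d where d: "d \<in> Arr D" "Dom D d = ob F X" "Cod D d = ob F (h (ob F X))"
      "d \<cdot>\<^bsub>D\<^esub> c (ob F X) = Ident D (ob F (h (ob F X)))" "c (ob F X) \<cdot>\<^bsub>D\<^esub> d = Ident D (ob F X)"
      using F.tgt.is_isoE[OF c_iso[OF FX] c_hom[OF FX]] by blast
    have "mor F (\<mu> X) = d \<cdot>\<^bsub>D\<^esub> (c (ob F X) \<cdot>\<^bsub>D\<^esub> mor F (\<mu> X))"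
      using \<mu>(1-3)[OF X] d FX by (simp add: F.tgt.Comp_cancel[OF d(4)] c_arr F.mor_arr)
    then have "mor F (\<mu> X) = d"
      using \<mu>(4)[OF X] d by (simp add: c)
    then have "is_iso D (mor F (\<mu> X))"
      using d FX F.tgt.is_isoI[of d _ _ "c (ob F X)"] by (simp add: Hom_iff c_arr)
    then show "is_iso C (\<mu> X)"
      using F.fully_faithful_reflects_isos[OF ff] \<mu>(1)[OF X] by (simp add: reflects_isos_def)
  next
    fix f X Y assume f: "f \<in> Hom C X Y"
    have obs: "X \<in> Obj C" "Y \<in> Obj C"
      using f F.src.Dom_closed F.src.Cod_closed by (auto simp: Hom_iff)
    note HFf = Ht(1-3)[of "mor F f"]
    have "c (ob F Y) \<cdot>\<^bsub>D\<^esub> mor F (mor H (mor F f) \<cdot>\<^bsub>C\<^esub> \<mu> X)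
        = (c (ob F Y) \<cdot>\<^bsub>D\<^esub> mor F (mor H (mor F f))) \<cdot>\<^bsub>D\<^esub> mor F (\<mu> X)"
      using f obs \<mu>(1-3) HFf by (simp add: Hom_iff c c_arr)
    also have "\<dots> = (mor F f \<cdot>\<^bsub>D\<^esub> c (ob F X)) \<cdot>\<^bsub>D\<^esub> mor F (\<mu> X)"
      using f obs Ht(4)[of "mor F f"] by (simp add: Hom_iff F.mor_arr)
    also have "\<dots> = mor F f"
      using f obs \<mu> by (simp add: Hom_iff c c_arr)
    also have "\<dots> = (c (ob F Y) \<cdot>\<^bsub>D\<^esub> mor F (\<mu> Y)) \<cdot>\<^bsub>D\<^esub> mor F f"
      using f obs \<mu> by (simp add: Hom_iff c)
    also have "\<dots> = c (ob F Y) \<cdot>\<^bsub>D\<^esub> mor F (\<mu> Y \<cdot>\<^bsub>C\<^esub> f)"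
      using f obs \<mu>(1-3) by (simp add: Hom_iff c c_arr)
    finally have "mor H (mor F f) \<cdot>\<^bsub>C\<^esub> \<mu> X = \<mu> Y \<cdot>\<^bsub>C\<^esub> f"
      using f obs \<mu>(1-3) HFf by (intro uniq[of _ X "ob F Y"]) (simp_all add: Hom_iff c)
    then show "mor (H \<odot> F) f \<cdot>\<^bsub>C\<^esub> \<mu> X = \<mu> Y \<cdot>\<^bsub>C\<^esub> mor id_ftor f"
      by (simp add: id_ftor_def comp_ftor_def)
  qed
  moreover have "nat_iso D D (F \<odot> H) id_ftor c"
  proof unfold_locales
    fix T assume T: "T \<in> Obj D"
    show "c T \<in> Hom D (ob (F \<odot> H) T) (ob id_ftor T)"
      using c_hom[OF T] by (simp add: H_def id_ftor_def comp_ftor_def)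
    show "is_iso D (c T)"
      by (rule c_iso[OF T])
  next
    fix t S T assume "t \<in> Hom D S T"
    then show "mor id_ftor t \<cdot>\<^bsub>D\<^esub> c S = c T \<cdot>\<^bsub>D\<^esub> mor (F \<odot> H) t"
      using Ht(4)[of t] by (simp add: Hom_iff id_ftor_def comp_ftor_def)
  qed
  ultimately show ?thesis
    unfolding is_equivalence_def using assms(1) H by blast
qed

text \<open>An object isomorphic to \<open>T\<close> in the image gives an isomorphism \<open>u : F Y \<rightarrow> T\<close>, and \<open>u = q \<circ> F k\<close>
  makes \<open>F k \<circ> u\<inverse>\<close> a section of \<open>q\<close>. Fullness writes \<open>u\<inverse> \<circ> q\<close> as \<open>F m\<close>, and the uniqueness clause forces
  \<open>k \<circ> m = id\<close>, so that the section is a two-sided inverse.\<close>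

lemma (in is_functor) couniversal_iso:
  assumes ff: "fully_faithful C D F" and es: "essentially_surjective C D F"
    and Z: "Z \<in> Obj C" and q: "q \<in> Hom D (ob F Z) T"
    and couniversal: "\<And>Y s. Y \<in> Obj C \<Longrightarrow> s \<in> Hom D (ob F Y) T
      \<Longrightarrow> \<exists>!k. k \<in> Hom C Y Z \<and> q \<cdot>\<^bsub>D\<^esub> mor F k = s"
  shows "is_iso D q"
proof -
  note c = src.arr_simps tgt.arr_simps functor_simps
  have T: "T \<in> Obj D"
    using q tgt.Cod_closed by (auto simp: Hom_iff)
  then obtain Y u where Y: "Y \<in> Obj C" and u: "u \<in> Hom D (ob F Y) T" and "is_iso D u"
    using es unfolding essentially_surjective_def by blast
  then obtain v where v: "v \<in> Arr D" "Dom D v = T" "Cod D v = ob F Y"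
    and uv: "u \<cdot>\<^bsub>D\<^esub> v = Ident D T"
    using tgt.is_isoE by metis
  obtain k where k: "k \<in> Hom C Y Z" and qk: "q \<cdot>\<^bsub>D\<^esub> mor F k = u"
    using couniversal[OF Y u] by blast
  have "v \<cdot>\<^bsub>D\<^esub> q \<in> Hom D (ob F Z) (ob F Y)"
    using v q by (simp add: Hom_iff c)
  then obtain m where m: "m \<in> Hom C Z Y" and Fm: "mor F m = v \<cdot>\<^bsub>D\<^esub> q"
    using fully_faithful_lift[OF ff _ Z Y] by blast
  have "q \<cdot>\<^bsub>D\<^esub> mor F (k \<cdot>\<^bsub>C\<^esub> m) = (q \<cdot>\<^bsub>D\<^esub> mor F k) \<cdot>\<^bsub>D\<^esub> mor F m"
    using k m q by (simp add: Hom_iff c)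
  also have "\<dots> = q"
    unfolding qk Fm using u v q tgt.Comp_cancel[OF uv] by (simp add: Hom_iff)
  finally have "q \<cdot>\<^bsub>D\<^esub> mor F (k \<cdot>\<^bsub>C\<^esub> m) = q" .
  moreover have "q \<cdot>\<^bsub>D\<^esub> mor F (Ident C Z) = q"
    using q Z by (simp add: Hom_iff c)
  moreover have "k \<cdot>\<^bsub>C\<^esub> m \<in> Hom C Z Z" "Ident C Z \<in> Hom C Z Z"
    using k m Z by (simp_all add: Hom_iff c)
  ultimately have km: "k \<cdot>\<^bsub>C\<^esub> m = Ident C Z"
    using couniversal[OF Z q] by blast
  show ?thesis
  proof (rule tgt.is_isoI[OF q])
    show "mor F k \<cdot>\<^bsub>D\<^esub> v \<in> Hom D T (ob F Z)"
      using k v by (simp add: Hom_iff c)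
    have "(mor F k \<cdot>\<^bsub>D\<^esub> v) \<cdot>\<^bsub>D\<^esub> q = mor F (k \<cdot>\<^bsub>C\<^esub> m)"
      using k m v q Fm by (simp add: Hom_iff c)
    then show "(mor F k \<cdot>\<^bsub>D\<^esub> v) \<cdot>\<^bsub>D\<^esub> q = Ident D (ob F Z)"
      using km Z by (simp add: c)
    have "q \<cdot>\<^bsub>D\<^esub> (mor F k \<cdot>\<^bsub>D\<^esub> v) = (q \<cdot>\<^bsub>D\<^esub> mor F k) \<cdot>\<^bsub>D\<^esub> v"
      using k v q by (simp add: Hom_iff c)
    then show "q \<cdot>\<^bsub>D\<^esub> (mor F k \<cdot>\<^bsub>D\<^esub> v) = Ident D T"
      using qk uv by simp
  qed
qed

section \<open>Isomorphisms of comonads\<close>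

text \<open>The inverses of the components automatically form a morphism of comonads: each required
  equation holds after composing with the epimorphism \<open>\<phi>\<^sub>X\<close>, where it becomes the corresponding
  equation for \<open>\<phi>\<close>.\<close>

lemma comonad_iso_iff_components:
  assumes \<phi>: "comonad_morphism A G \<Delta> \<epsilon> G' \<Delta>' \<epsilon>' \<phi>"
  shows "is_comonad_iso A G \<Delta> \<epsilon> G' \<Delta>' \<epsilon>' \<phi> \<longleftrightarrow> (\<forall>X \<in> Obj A. is_iso A (\<phi> X))"
proof
  interpret \<phi>: comonad_morphism A G \<Delta> \<epsilon> G' \<Delta>' \<epsilon>' \<phi> by fact
  assume "is_comonad_iso A G \<Delta> \<epsilon> G' \<Delta>' \<epsilon>' \<phi>"
  then obtain \<psi> where \<psi>: "comonad_morphism A G' \<Delta>' \<epsilon>' G \<Delta> \<epsilon> \<psi>"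
    and inv: "\<And>X. X \<in> Obj A \<Longrightarrow> \<psi> X \<cdot>\<^bsub>A\<^esub> \<phi> X = Ident A (ob G X) \<and> \<phi> X \<cdot>\<^bsub>A\<^esub> \<psi> X = Ident A (ob G' X)"
    unfolding is_comonad_iso_def by blast
  interpret \<psi>: comonad_morphism A G' \<Delta>' \<epsilon>' G \<Delta> \<epsilon> \<psi> by fact
  show "\<forall>X \<in> Obj A. is_iso A (\<phi> X)"
    using inv \<phi>.src.comult.src.src.is_isoI[OF \<phi>.component_Hom \<psi>.component_Hom] by blast
next
  interpret A: category A
    using \<phi> by (meson comonad.axioms(1) comonad_morphism.axioms(1) is_functor.axioms(1) nat_trans.axioms(1))
  interpret G: is_functor A A G
    using \<phi> by (meson comonad.axioms(1) comonad_morphism.axioms(1) nat_trans.axioms(1))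
  interpret G': is_functor A A G'
    using \<phi> by (meson comonad.axioms(1) comonad_morphism.axioms(2) nat_trans.axioms(1))
  interpret \<phi>: comonad_morphism A G \<Delta> \<epsilon> G' \<Delta>' \<epsilon>' \<phi> by fact
  note c = A.arr_simps G.functor_simps G'.functor_simps \<phi>.component_arr
    \<phi>.src.comult.component_arr[unfolded comp_ftor_def, simplified]
    \<phi>.tgt.comult.component_arr[unfolded comp_ftor_def, simplified]
    \<phi>.src.counit.component_arr[unfolded id_ftor_def, simplified]
    \<phi>.tgt.counit.component_arr[unfolded id_ftor_def, simplified]
  assume "\<forall>X \<in> Obj A. is_iso A (\<phi> X)"
  then have "\<forall>X \<in> Obj A. \<exists>g. g \<in> Arr A \<and> Dom A g = ob G' X \<and> Cod A g = ob G X \<and>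
    g \<cdot>\<^bsub>A\<^esub> \<phi> X = Ident A (ob G X) \<and> \<phi> X \<cdot>\<^bsub>A\<^esub> g = Ident A (ob G' X)"
    using A.is_isoE[OF _ \<phi>.component_Hom] by metis
  then obtain \<psi> where \<psi>: "\<And>X. X \<in> Obj A \<Longrightarrow> \<psi> X \<in> Arr A" "\<And>X. X \<in> Obj A \<Longrightarrow> Dom A (\<psi> X) = ob G' X"
    "\<And>X. X \<in> Obj A \<Longrightarrow> Cod A (\<psi> X) = ob G X"
    and \<psi>\<phi>: "\<And>X. X \<in> Obj A \<Longrightarrow> \<psi> X \<cdot>\<^bsub>A\<^esub> \<phi> X = Ident A (ob G X)"
    and \<phi>\<psi>: "\<And>X. X \<in> Obj A \<Longrightarrow> \<phi> X \<cdot>\<^bsub>A\<^esub> \<psi> X = Ident A (ob G' X)"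
    by metis
  have epi: "a = b"
    if "a \<cdot>\<^bsub>A\<^esub> \<phi> X = b \<cdot>\<^bsub>A\<^esub> \<phi> X" "a \<in> Arr A" "b \<in> Arr A" "Dom A a = ob G' X" "Dom A b = ob G' X"
      "X \<in> Obj A" for a b X
  proof -
    have "(r \<cdot>\<^bsub>A\<^esub> \<phi> X) \<cdot>\<^bsub>A\<^esub> \<psi> X = r" if "r \<in> Arr A" "Dom A r = ob G' X" for r
      using that \<open>X \<in> Obj A\<close> \<psi> \<phi>\<psi> by (simp add: c)
    then show ?thesis
      using that by metis
  qed
  have nat: "mor G f \<cdot>\<^bsub>A\<^esub> \<psi> X = \<psi> Y \<cdot>\<^bsub>A\<^esub> mor G' f" 
    if "f \<in> Arr A" "Dom A f = X" "Cod A f = Y" for f X Y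
  proof (rule epi)
    have obs: "X \<in> Obj A" "Y \<in> Obj A"
      using that A.arr_simps by auto
    have "(\<psi> Y \<cdot>\<^bsub>A\<^esub> mor G' f) \<cdot>\<^bsub>A\<^esub> \<phi> X = \<psi> Y \<cdot>\<^bsub>A\<^esub> (\<phi> Y \<cdot>\<^bsub>A\<^esub> mor G f)"
      using that obs \<psi> \<phi>.naturality_arr[OF that] by (simp add: c)
    also have "\<dots> = (mor G f \<cdot>\<^bsub>A\<^esub> \<psi> X) \<cdot>\<^bsub>A\<^esub> \<phi> X"
      using that obs \<psi> \<psi>\<phi> by (simp add: c A.Comp_cancel[OF \<psi>\<phi>])
    finally show "(mor G f \<cdot>\<^bsub>A\<^esub> \<psi> X) \<cdot>\<^bsub>A\<^esub> \<phi> X = (\<psi> Y \<cdot>\<^bsub>A\<^esub> mor G' f) \<cdot>\<^bsub>A\<^esub> \<phi> X"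
      by simp
  qed (use that \<psi> A.arr_simps(1,2) in \<open>auto simp: c\<close>)
  have "comonad_morphism A G' \<Delta>' \<epsilon>' G \<Delta> \<epsilon> \<psi>"
  proof unfold_locales
    fix X assume X: "X \<in> Obj A"
    show "\<psi> X \<in> Hom A (ob G' X) (ob G X)"
      using X \<psi> by (simp add: Hom_iff)
    show "\<epsilon> X \<cdot>\<^bsub>A\<^esub> \<psi> X = \<epsilon>' X"
      by (rule epi[OF _ _ _ _ _ X]) (use X \<psi> \<psi>\<phi> \<phi>.counit_compat in \<open>simp_all add: c\<close>)
    show "\<Delta> X \<cdot>\<^bsub>A\<^esub> \<psi> X = (\<psi> (ob G X) \<cdot>\<^bsub>A\<^esub> mor G' (\<psi> X)) \<cdot>\<^bsub>A\<^esub> \<Delta>' X"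
    proof (rule epi[OF _ _ _ _ _ X])
      have "((\<psi> (ob G X) \<cdot>\<^bsub>A\<^esub> mor G' (\<psi> X)) \<cdot>\<^bsub>A\<^esub> \<Delta>' X) \<cdot>\<^bsub>A\<^esub> \<phi> X
          = \<psi> (ob G X) \<cdot>\<^bsub>A\<^esub> (mor G' (\<psi> X) \<cdot>\<^bsub>A\<^esub> (\<Delta>' X \<cdot>\<^bsub>A\<^esub> \<phi> X))"
        using X \<psi> by (simp add: c)
      also have "\<Delta>' X \<cdot>\<^bsub>A\<^esub> \<phi> X = \<phi> (ob G' X) \<cdot>\<^bsub>A\<^esub> (mor G (\<phi> X) \<cdot>\<^bsub>A\<^esub> \<Delta> X)"
        using X \<phi>.comult_compat[OF X] by (simp add: c)
      also have "mor G' (\<psi> X) \<cdot>\<^bsub>A\<^esub> \<dots> = \<phi> (ob G X) \<cdot>\<^bsub>A\<^esub> (mor G (\<psi> X) \<cdot>\<^bsub>A\<^esub> (mor G (\<phi> X) \<cdot>\<^bsub>A\<^esub> \<Delta> X))"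
        using X \<psi> by (intro A.Comp_extend \<phi>.naturality_arr) (simp_all add: c)
      also have "mor G (\<psi> X) \<cdot>\<^bsub>A\<^esub> (mor G (\<phi> X) \<cdot>\<^bsub>A\<^esub> \<Delta> X) = mor G (\<psi> X \<cdot>\<^bsub>A\<^esub> \<phi> X) \<cdot>\<^bsub>A\<^esub> \<Delta> X"
        using X \<psi> by (simp add: c)
      also have "\<dots> = \<Delta> X"
        using X \<psi>\<phi>[OF X] by (simp add: c)
      also have "\<psi> (ob G X) \<cdot>\<^bsub>A\<^esub> (\<phi> (ob G X) \<cdot>\<^bsub>A\<^esub> \<Delta> X) = \<Delta> X"
        using X \<psi> by (intro A.Comp_cancel[OF \<psi>\<phi>]) (simp_all add: c)
      finally show "(\<Delta> X \<cdot>\<^bsub>A\<^esub> \<psi> X) \<cdot>\<^bsub>A\<^esub> \<phi> X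
          = ((\<psi> (ob G X) \<cdot>\<^bsub>A\<^esub> mor G' (\<psi> X)) \<cdot>\<^bsub>A\<^esub> \<Delta>' X) \<cdot>\<^bsub>A\<^esub> \<phi> X"
        using X \<psi> \<psi>\<phi>[OF X] by (simp add: c)
    qed (use X \<psi> in \<open>simp_all add: c\<close>)
  next
    fix f X Y assume "f \<in> Hom A X Y"
    then show "mor G f \<cdot>\<^bsub>A\<^esub> \<psi> X = \<psi> Y \<cdot>\<^bsub>A\<^esub> mor G' f"
      using nat by (simp add: Hom_iff)
  qed
  then show "is_comonad_iso A G \<Delta> \<epsilon> G' \<Delta>' \<epsilon>' \<phi>"
    unfolding is_comonad_iso_def using \<phi> \<psi>\<phi> \<phi>\<psi> by blast
qed


section \<open>Coalgebra maps as equalizing arrows\<close>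

locale comonad_comparison =
  B: category B + A: category A + L: is_functor B A L + R: is_functor A B R + G: is_functor A A G +
  adj: adjunction B A L R \<eta> \<epsilon> + comonad: comonad A G \<Delta> \<epsilon>G +
  \<phi>: comonad_morphism A "L \<odot> R" "adj_comult L R \<eta>" \<epsilon> G \<Delta> \<epsilon>G \<phi>
  for B :: "('p, 'n) category" and A :: "('o, 'm) category"
    and L :: "('p, 'n, 'o, 'm) ftor" and R :: "('o, 'm, 'p, 'n) ftor"
    and \<eta> :: "'p \<Rightarrow> 'n" and \<epsilon> :: "'o \<Rightarrow> 'm"
    and G :: "('o, 'm, 'o, 'm) ftor" and \<Delta> :: "'o \<Rightarrow> 'm" and \<epsilon>G :: "'o \<Rightarrow> 'm"
    and \<phi> :: "'o \<Rightarrow> 'm"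
begin

abbreviation \<alpha> :: "'o \<Rightarrow> 'n" where
  "\<alpha> \<equiv> comparison_\<alpha> B R \<eta> \<phi>"

abbreviation \<kappa> :: "'p \<Rightarrow> 'm" where
  "\<kappa> Y \<equiv> \<phi> (ob L Y) \<cdot>\<^bsub>A\<^esub> mor L (\<eta> Y)"

lemmas components =
  adj.unit.component_arr[unfolded id_ftor_def comp_ftor_def, simplified]
  adj.counit.component_arr[unfolded id_ftor_def comp_ftor_def, simplified]
  comonad.comult.component_arr[unfolded id_ftor_def comp_ftor_def, simplified]
  comonad.counit.component_arr[unfolded id_ftor_def comp_ftor_def, simplified]
  \<phi>.component_arr[unfolded id_ftor_def comp_ftor_def, simplified]

lemmas arrs = B.arr_simps A.arr_simps L.functor_simps R.functor_simps G.functor_simps components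

lemmas unit_nat = adj.unit.naturality_arr[unfolded id_ftor_def comp_ftor_def, simplified]
lemmas counit_nat = adj.counit.naturality_arr[unfolded id_ftor_def comp_ftor_def, simplified]
lemmas comonad_counit_nat = comonad.counit.naturality_arr[unfolded id_ftor_def comp_ftor_def, simplified]
lemmas \<phi>_nat = \<phi>.naturality_arr[unfolded id_ftor_def comp_ftor_def, simplified]

lemma \<alpha>_arr:
  assumes "X \<in> Obj A"
  shows "\<alpha> X \<in> Arr B" "Dom B (\<alpha> X) = ob R X" "Cod B (\<alpha> X) = ob R (ob G X)"
  using assms by (simp_all add: comparison_\<alpha>_def arrs)

lemma counit_transpose:
  assumes f: "f \<in> Arr A" "Dom A f = ob L Y" "Cod A f = X" and Y: "Y \<in> Obj B"
  shows "\<epsilon> X \<cdot>\<^bsub>A\<^esub> mor L (mor R f \<cdot>\<^bsub>B\<^esub> \<eta> Y) = f"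
proof -
  have X: "X \<in> Obj A"
    using f A.Cod_closed by auto
  have "\<epsilon> X \<cdot>\<^bsub>A\<^esub> mor L (mor R f \<cdot>\<^bsub>B\<^esub> \<eta> Y) = (\<epsilon> X \<cdot>\<^bsub>A\<^esub> mor L (mor R f)) \<cdot>\<^bsub>A\<^esub> mor L (\<eta> Y)"
    using f X Y by (simp add: arrs)
  also have "\<dots> = f \<cdot>\<^bsub>A\<^esub> (\<epsilon> (ob L Y) \<cdot>\<^bsub>A\<^esub> mor L (\<eta> Y))"
    using f X Y counit_nat[OF f] by (simp add: arrs flip: counit_nat[OF f])
  also have "\<dots> = f"
    using f Y adj.triangle_left[OF Y] by (simp add: arrs)
  finally show ?thesis .
qed

lemma transpose_counit:
  assumes g: "g \<in> Arr B" "Dom B g = Y" "Cod B g = ob R X" and X: "X \<in> Obj A"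
  shows "mor R (\<epsilon> X \<cdot>\<^bsub>A\<^esub> mor L g) \<cdot>\<^bsub>B\<^esub> \<eta> Y = g"
proof -
  have Y: "Y \<in> Obj B"
    using g B.Dom_closed by auto
  have "mor R (\<epsilon> X \<cdot>\<^bsub>A\<^esub> mor L g) \<cdot>\<^bsub>B\<^esub> \<eta> Y = mor R (\<epsilon> X) \<cdot>\<^bsub>B\<^esub> (mor R (mor L g) \<cdot>\<^bsub>B\<^esub> \<eta> Y)"
    using g X Y by (simp add: arrs)
  also have "\<dots> = mor R (\<epsilon> X) \<cdot>\<^bsub>B\<^esub> (\<eta> (ob R X) \<cdot>\<^bsub>B\<^esub> g)"
    using unit_nat[OF g] by simp
  also have "\<dots> = g"
    using g X by (simp add: arrs B.Comp_cancel[OF adj.triangle_right])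
  finally show ?thesis .
qed

lemma counit_L_inj:
  assumes g: "g \<in> Hom B Y (ob R X)" and g': "g' \<in> Hom B Y (ob R X)" and X: "X \<in> Obj A"
    and eq: "\<epsilon> X \<cdot>\<^bsub>A\<^esub> mor L g = \<epsilon> X \<cdot>\<^bsub>A\<^esub> mor L g'"
  shows "g = g'"
proof -
  have "r = mor R (\<epsilon> X \<cdot>\<^bsub>A\<^esub> mor L r) \<cdot>\<^bsub>B\<^esub> \<eta> Y" if "r \<in> Hom B Y (ob R X)" for r
    using transpose_counit[OF _ _ _ X] that by (simp add: Hom_iff)
  then show ?thesis
    using g g' eq by metis
qed

lemma G_coaction:
  assumes f: "f \<in> Arr A" "Dom A f = ob L Y" "Cod A f = X" and Y: "Y \<in> Obj B"
  shows "mor G f \<cdot>\<^bsub>A\<^esub> \<kappa> Y = \<phi> X \<cdot>\<^bsub>A\<^esub> mor L (mor R f \<cdot>\<^bsub>B\<^esub> \<eta> Y)"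
proof -
  have X: "X \<in> Obj A"
    using f A.Cod_closed by auto
  have "mor G f \<cdot>\<^bsub>A\<^esub> \<kappa> Y = \<phi> X \<cdot>\<^bsub>A\<^esub> (mor L (mor R f) \<cdot>\<^bsub>A\<^esub> mor L (\<eta> Y))"
    using f X Y by (intro A.Comp_extend \<phi>_nat) (simp_all add: arrs)
  then show ?thesis
    using f X Y by (simp add: arrs)
qed

lemma \<alpha>_transpose:
  assumes g: "g \<in> Arr B" "Dom B g = Y" "Cod B g = ob R X" and X: "X \<in> Obj A"
  shows "mor R (\<phi> X \<cdot>\<^bsub>A\<^esub> mor L g) \<cdot>\<^bsub>B\<^esub> \<eta> Y = \<alpha> X \<cdot>\<^bsub>B\<^esub> g"
proof -
  have Y: "Y \<in> Obj B"
    using g B.Dom_closed by auto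
  have "mor R (\<phi> X \<cdot>\<^bsub>A\<^esub> mor L g) \<cdot>\<^bsub>B\<^esub> \<eta> Y = mor R (\<phi> X) \<cdot>\<^bsub>B\<^esub> (mor R (mor L g) \<cdot>\<^bsub>B\<^esub> \<eta> Y)"
    using g X Y by (simp add: arrs)
  also have "\<dots> = mor R (\<phi> X) \<cdot>\<^bsub>B\<^esub> (\<eta> (ob R X) \<cdot>\<^bsub>B\<^esub> g)"
    using unit_nat[OF g] by simp
  finally show ?thesis
    using g X by (simp add: comparison_\<alpha>_def arrs)
qed

lemma coalgebraD:
  assumes "is_coalgebra A G \<Delta> \<epsilon>G X x"
  shows "X \<in> Obj A" "x \<in> Arr A" "Dom A x = X" "Cod A x = ob G X"
    "mor G x \<cdot>\<^bsub>A\<^esub> x = \<Delta> X \<cdot>\<^bsub>A\<^esub> x" "\<epsilon>G X \<cdot>\<^bsub>A\<^esub> x = Ident A X"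
  using assms by (simp_all add: is_coalgebra_def Hom_iff)

text \<open>Both sides on the right are arrows \<open>L Y \<rightarrow> G X\<close>; their transposes are the two sides on the
  left.\<close>

lemma equalizing_iff:
  assumes x: "is_coalgebra A G \<Delta> \<epsilon>G X x" and g: "g \<in> Hom B Y (ob R X)"
  shows "\<alpha> X \<cdot>\<^bsub>B\<^esub> g = mor R x \<cdot>\<^bsub>B\<^esub> g \<longleftrightarrow> \<phi> X \<cdot>\<^bsub>A\<^esub> mor L g = x \<cdot>\<^bsub>A\<^esub> (\<epsilon> X \<cdot>\<^bsub>A\<^esub> mor L g)"
    (is "?l \<longleftrightarrow> ?f = ?f'")
proof -
  note x = coalgebraD[OF x]
  have g: "g \<in> Arr B" "Dom B g = Y" "Cod B g = ob R X" and Y: "Y \<in> Obj B"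
    using g B.Dom_closed by (auto simp: Hom_iff)
  have "mor R ?f' \<cdot>\<^bsub>B\<^esub> \<eta> Y = mor R x \<cdot>\<^bsub>B\<^esub> (mor R (\<epsilon> X \<cdot>\<^bsub>A\<^esub> mor L g) \<cdot>\<^bsub>B\<^esub> \<eta> Y)"
    using g x(1-4) Y by (simp add: arrs)
  then have "mor R ?f' \<cdot>\<^bsub>B\<^esub> \<eta> Y = mor R x \<cdot>\<^bsub>B\<^esub> g"
    using transpose_counit[OF g x(1)] by simp
  moreover have "mor R ?f \<cdot>\<^bsub>B\<^esub> \<eta> Y = \<alpha> X \<cdot>\<^bsub>B\<^esub> g"
    by (rule \<alpha>_transpose[OF g x(1)])
  moreover have "?f = ?f' \<longleftrightarrow> mor R ?f \<cdot>\<^bsub>B\<^esub> \<eta> Y = mor R ?f' \<cdot>\<^bsub>B\<^esub> \<eta> Y"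
  proof
    assume eq: "mor R ?f \<cdot>\<^bsub>B\<^esub> \<eta> Y = mor R ?f' \<cdot>\<^bsub>B\<^esub> \<eta> Y"
    have "\<epsilon> (ob G X) \<cdot>\<^bsub>A\<^esub> mor L (mor R ?f \<cdot>\<^bsub>B\<^esub> \<eta> Y) = ?f"
      using g x(1-4) Y by (intro counit_transpose) (simp_all add: arrs)
    moreover have "\<epsilon> (ob G X) \<cdot>\<^bsub>A\<^esub> mor L (mor R ?f' \<cdot>\<^bsub>B\<^esub> \<eta> Y) = ?f'"
      using g x(1-4) Y by (intro counit_transpose) (simp_all add: arrs)
    ultimately show "?f = ?f'"
      using eq by metis
  qed simp
  ultimately show ?thesis
    by metis
qed

text \<open>This is why an equalizer of \<open>\<alpha>\<^sub>X\<close> and \<open>R x\<close> represents coalgebra maps \<open>K Y \<rightarrow> (X, x)\<close> as a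
  functor of \<open>Y\<close>, so that these equalizers are the values of a right adjoint of \<open>K\<close>.\<close>

lemma coalgebra_map_iff:
  assumes x: "is_coalgebra A G \<Delta> \<epsilon>G X x" and f: "f \<in> Hom A (ob L Y) X" and Y: "Y \<in> Obj B"
  shows "mor G f \<cdot>\<^bsub>A\<^esub> \<kappa> Y = x \<cdot>\<^bsub>A\<^esub> f \<longleftrightarrow>
    \<alpha> X \<cdot>\<^bsub>B\<^esub> (mor R f \<cdot>\<^bsub>B\<^esub> \<eta> Y) = mor R x \<cdot>\<^bsub>B\<^esub> (mor R f \<cdot>\<^bsub>B\<^esub> \<eta> Y)"
proof -
  have f: "f \<in> Arr A" "Dom A f = ob L Y" "Cod A f = X"
    using f by (simp_all add: Hom_iff)
  have "mor R f \<cdot>\<^bsub>B\<^esub> \<eta> Y \<in> Hom B Y (ob R X)"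
    using f Y by (simp add: Hom_iff arrs)
  then show ?thesis
    using equalizing_iff[OF x] G_coaction[OF f Y] counit_transpose[OF f Y] by simp
qed

lemma equalizerD:
  assumes "is_coalgebra A G \<Delta> \<epsilon>G X x" and "is_equalizer B (\<alpha> X) (mor R x) E e"
  shows "E \<in> Obj B" "e \<in> Arr B" "Dom B e = E" "Cod B e = ob R X"
    "\<alpha> X \<cdot>\<^bsub>B\<^esub> e = mor R x \<cdot>\<^bsub>B\<^esub> e"
    "\<And>Z h. Z \<in> Obj B \<Longrightarrow> h \<in> Hom B Z (ob R X) \<Longrightarrow> \<alpha> X \<cdot>\<^bsub>B\<^esub> h = mor R x \<cdot>\<^bsub>B\<^esub> h
      \<Longrightarrow> \<exists>!k. k \<in> Hom B Z E \<and> e \<cdot>\<^bsub>B\<^esub> k = h"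
  using assms(2) \<alpha>_arr[OF coalgebraD(1)[OF assms(1)]] unfolding is_equalizer_def
  by (auto simp: Hom_iff)

lemma equalizer_coalgebra_map:
  assumes x: "is_coalgebra A G \<Delta> \<epsilon>G X x" and e: "is_equalizer B (\<alpha> X) (mor R x) E e"
  shows "\<epsilon> X \<cdot>\<^bsub>A\<^esub> mor L e \<in> Hom A (ob L E) X"
    and "mor G (\<epsilon> X \<cdot>\<^bsub>A\<^esub> mor L e) \<cdot>\<^bsub>A\<^esub> \<kappa> E = x \<cdot>\<^bsub>A\<^esub> (\<epsilon> X \<cdot>\<^bsub>A\<^esub> mor L e)"
proof -
  note xD = coalgebraD[OF x] and eD = equalizerD[OF x e]
  show p: "\<epsilon> X \<cdot>\<^bsub>A\<^esub> mor L e \<in> Hom A (ob L E) X"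
    using xD(1) eD(1-4) by (simp add: Hom_iff arrs)
  have "mor R (\<epsilon> X \<cdot>\<^bsub>A\<^esub> mor L e) \<cdot>\<^bsub>B\<^esub> \<eta> E = e"
    by (rule transpose_counit[OF eD(2-4) xD(1)])
  then show "mor G (\<epsilon> X \<cdot>\<^bsub>A\<^esub> mor L e) \<cdot>\<^bsub>A\<^esub> \<kappa> E = x \<cdot>\<^bsub>A\<^esub> (\<epsilon> X \<cdot>\<^bsub>A\<^esub> mor L e)"
    using coalgebra_map_iff[OF x p eD(1)] eD(5) by simp
qed

section \<open>Preservation of the equalizers\<close>

text \<open>The fork \<open>X \<rightarrow> G X \<rightrightarrows> G G X\<close> is split by \<open>\<epsilon>G\<^sub>X\<close> and \<open>\<epsilon>G\<^sub>G\<^sub>X\<close>, so an arrow equalizing the parallel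
  pair factors through \<open>x\<close> by its composite with \<open>\<epsilon>G\<^sub>X\<close>.\<close>

lemma coalgebra_split:
  assumes x: "is_coalgebra A G \<Delta> \<epsilon>G X x" and h: "h \<in> Arr A" "Cod A h = ob G X"
    and eq: "\<Delta> X \<cdot>\<^bsub>A\<^esub> h = mor G x \<cdot>\<^bsub>A\<^esub> h"
  shows "h = x \<cdot>\<^bsub>A\<^esub> (\<epsilon>G X \<cdot>\<^bsub>A\<^esub> h)"
proof -
  note x = coalgebraD[OF x]
  have "h = \<epsilon>G (ob G X) \<cdot>\<^bsub>A\<^esub> (\<Delta> X \<cdot>\<^bsub>A\<^esub> h)"
    using x(1) h by (simp add: arrs A.Comp_cancel[OF comonad.counit_left])
  also have "\<dots> = \<epsilon>G (ob G X) \<cdot>\<^bsub>A\<^esub> (mor G x \<cdot>\<^bsub>A\<^esub> h)"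
    using eq by simp
  also have "\<dots> = x \<cdot>\<^bsub>A\<^esub> (\<epsilon>G X \<cdot>\<^bsub>A\<^esub> h)"
    using x(1-4) h by (intro A.Comp_extend comonad_counit_nat[symmetric]) (simp_all add: arrs)
  finally show ?thesis .
qed

text \<open>This is the comultiplication law of \<open>\<phi>\<close>. Together with naturality at \<open>x\<close>, it says that \<open>\<phi>\<close> maps the
  pair \<open>L \<alpha>\<^sub>X\<close>, \<open>L R x\<close> to the pair \<open>\<Delta>\<^sub>X\<close>, \<open>G x\<close>.\<close>

lemma \<phi>_L_\<alpha>:
  assumes X: "X \<in> Obj A"
  shows "\<phi> (ob G X) \<cdot>\<^bsub>A\<^esub> mor L (\<alpha> X) = \<Delta> X \<cdot>\<^bsub>A\<^esub> \<phi> X"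
  using \<phi>.comult_compat[OF X] X by (simp add: comparison_\<alpha>_def adj_comult_def comp_ftor_def arrs)

lemma \<phi>_counit: "X \<in> Obj A \<Longrightarrow> \<epsilon>G X \<cdot>\<^bsub>A\<^esub> \<phi> X = \<epsilon> X"
  by (rule \<phi>.counit_compat)

lemma equalizing_image:
  assumes x: "is_coalgebra A G \<Delta> \<epsilon>G X x" and h: "h \<in> Arr A" "Cod A h = ob L (ob R X)"
    and eq: "mor L (\<alpha> X) \<cdot>\<^bsub>A\<^esub> h = mor L (mor R x) \<cdot>\<^bsub>A\<^esub> h"
  shows "\<phi> X \<cdot>\<^bsub>A\<^esub> h = x \<cdot>\<^bsub>A\<^esub> (\<epsilon> X \<cdot>\<^bsub>A\<^esub> h)"
proof -
  note xD = coalgebraD[OF x]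
  note c = arrs \<alpha>_arr
  have "\<Delta> X \<cdot>\<^bsub>A\<^esub> (\<phi> X \<cdot>\<^bsub>A\<^esub> h) = \<phi> (ob G X) \<cdot>\<^bsub>A\<^esub> (mor L (\<alpha> X) \<cdot>\<^bsub>A\<^esub> h)"
    using xD(1) h by (intro A.Comp_extend \<phi>_L_\<alpha>[symmetric]) (simp_all add: c)
  also have "\<dots> = mor G x \<cdot>\<^bsub>A\<^esub> (\<phi> X \<cdot>\<^bsub>A\<^esub> h)"
    unfolding eq using xD(1-4) h by (intro A.Comp_extend \<phi>_nat[symmetric]) (simp_all add: c)
  finally have "\<phi> X \<cdot>\<^bsub>A\<^esub> h = x \<cdot>\<^bsub>A\<^esub> (\<epsilon>G X \<cdot>\<^bsub>A\<^esub> (\<phi> X \<cdot>\<^bsub>A\<^esub> h))"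
    using xD(1) h by (intro coalgebra_split[OF x]) (simp_all add: c)
  also have "\<epsilon>G X \<cdot>\<^bsub>A\<^esub> (\<phi> X \<cdot>\<^bsub>A\<^esub> h) = \<epsilon> X \<cdot>\<^bsub>A\<^esub> h"
    using xD(1) h by (simp add: c flip: \<phi>_counit)
  finally show ?thesis .
qed

text \<open>An arrow \<open>h\<close> equalizing the image pair satisfies \<open>\<phi>\<^sub>X \<circ> h = x \<circ> \<epsilon>\<^sub>X \<circ> h\<close>, while
  \<open>\<phi>\<^sub>X \<circ> L e = x \<circ> p\<close> for \<open>p = \<epsilon>\<^sub>X \<circ> L e\<close>. So \<open>p\<inverse> \<circ> \<epsilon>\<^sub>X \<circ> h\<close> is the factorization of \<open>h\<close>, and it is
  determined by \<open>h\<close> because \<open>p \<circ> k = \<epsilon>\<^sub>X \<circ> L e \<circ> k\<close>.\<close>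

lemma L_equalizer_if_iso:
  assumes x: "is_coalgebra A G \<Delta> \<epsilon>G X x" and e: "is_equalizer B (\<alpha> X) (mor R x) E e"
    and \<phi>_iso: "is_iso A (\<phi> X)" and p_iso: "is_iso A (\<epsilon> X \<cdot>\<^bsub>A\<^esub> mor L e)"
  shows "is_equalizer A (mor L (\<alpha> X)) (mor L (mor R x)) (ob L E) (mor L e)"
proof -
  note xD = coalgebraD[OF x] and eD = equalizerD[OF x e]
  note c = arrs \<alpha>_arr
  define p where "p = \<epsilon> X \<cdot>\<^bsub>A\<^esub> mor L e"
  have p: "p \<in> Hom A (ob L E) X"
    using xD(1) eD(1-4) by (simp add: p_def Hom_iff c)
  have \<phi>e: "\<phi> X \<cdot>\<^bsub>A\<^esub> mor L e = x \<cdot>\<^bsub>A\<^esub> p"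
    using equalizing_iff[OF x, of e E] eD(2-5) by (simp add: Hom_iff p_def)
  obtain q where q: "q \<in> Arr A" "Dom A q = X" "Cod A q = ob L E"
      "q \<cdot>\<^bsub>A\<^esub> p = Ident A (ob L E)" "p \<cdot>\<^bsub>A\<^esub> q = Ident A X"
    using A.is_isoE[OF p_iso[folded p_def] p] by blast
  obtain \<psi> where \<psi>: "\<psi> \<in> Arr A" "Dom A \<psi> = ob G X" "Cod A \<psi> = ob L (ob R X)"
      "\<psi> \<cdot>\<^bsub>A\<^esub> \<phi> X = Ident A (ob L (ob R X))"
    using A.is_isoE[OF \<phi>_iso \<phi>.component_Hom[OF xD(1)]] by (auto simp: comp_ftor_def)
  have lift: "\<exists>!k. k \<in> Hom A Z (ob L E) \<and> mor L e \<cdot>\<^bsub>A\<^esub> k = h"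
    if Z: "Z \<in> Obj A" and h: "h \<in> Arr A" "Dom A h = Z" "Cod A h = ob L (ob R X)"
      and eq: "mor L (\<alpha> X) \<cdot>\<^bsub>A\<^esub> h = mor L (mor R x) \<cdot>\<^bsub>A\<^esub> h" for Z h
  proof (rule ex1I[of _ "q \<cdot>\<^bsub>A\<^esub> (\<epsilon> X \<cdot>\<^bsub>A\<^esub> h)"], intro conjI)
    let ?k = "q \<cdot>\<^bsub>A\<^esub> (\<epsilon> X \<cdot>\<^bsub>A\<^esub> h)"
    show k: "?k \<in> Hom A Z (ob L E)"
      using q h xD(1) by (simp add: Hom_iff c)
    have pk: "p \<cdot>\<^bsub>A\<^esub> ?k = \<epsilon> X \<cdot>\<^bsub>A\<^esub> h"
      using p q(1-3) h xD(1) by (intro A.Comp_cancel[OF q(5)]) (simp_all add: Hom_iff c)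
    have "\<phi> X \<cdot>\<^bsub>A\<^esub> (mor L e \<cdot>\<^bsub>A\<^esub> ?k) = x \<cdot>\<^bsub>A\<^esub> (p \<cdot>\<^bsub>A\<^esub> ?k)"
      using k p xD(1-4) eD(1-4) by (intro A.Comp_extend \<phi>e) (simp_all add: Hom_iff c)
    also have "\<dots> = \<phi> X \<cdot>\<^bsub>A\<^esub> h"
      using equalizing_image[OF x h(1,3) eq] pk by simp
    finally have "\<psi> \<cdot>\<^bsub>A\<^esub> (\<phi> X \<cdot>\<^bsub>A\<^esub> (mor L e \<cdot>\<^bsub>A\<^esub> ?k)) = \<psi> \<cdot>\<^bsub>A\<^esub> (\<phi> X \<cdot>\<^bsub>A\<^esub> h)"
      by simp
    moreover have "\<psi> \<cdot>\<^bsub>A\<^esub> (\<phi> X \<cdot>\<^bsub>A\<^esub> r) = r" if "r \<in> Arr A" "Cod A r = ob L (ob R X)" for r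
      using that \<psi>(1-3) xD(1) by (intro A.Comp_cancel[OF \<psi>(4)]) (simp_all add: c)
    moreover have "mor L e \<cdot>\<^bsub>A\<^esub> ?k \<in> Arr A" "Cod A (mor L e \<cdot>\<^bsub>A\<^esub> ?k) = ob L (ob R X)"
      using k eD(1-4) by (simp_all add: Hom_iff L.mor_arr A.Comp_arr)
    ultimately show "mor L e \<cdot>\<^bsub>A\<^esub> ?k = h"
      using h by metis
  next
    fix k assume k: "k \<in> Hom A Z (ob L E) \<and> mor L e \<cdot>\<^bsub>A\<^esub> k = h"
    have "k = q \<cdot>\<^bsub>A\<^esub> (p \<cdot>\<^bsub>A\<^esub> k)"
      using k p q(1-3) A.Comp_cancel[OF q(4), of k] by (simp add: Hom_iff)
    also have "p \<cdot>\<^bsub>A\<^esub> k = \<epsilon> X \<cdot>\<^bsub>A\<^esub> (mor L e \<cdot>\<^bsub>A\<^esub> k)"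
      unfolding p_def using k xD(1) eD(1-4) by (intro A.Comp_assoc_arr) (simp_all add: Hom_iff c)
    finally show "k = q \<cdot>\<^bsub>A\<^esub> (\<epsilon> X \<cdot>\<^bsub>A\<^esub> h)"
      using k by simp
  qed
  have "mor L (\<alpha> X \<cdot>\<^bsub>B\<^esub> e) = mor L (mor R x \<cdot>\<^bsub>B\<^esub> e)"
    using eD(5) by simp
  then have "mor L (\<alpha> X) \<cdot>\<^bsub>A\<^esub> mor L e = mor L (mor R x) \<cdot>\<^bsub>A\<^esub> mor L e"
    using eD(1-4) xD(1-4) by (simp add: c)
  moreover have dom: "Dom A (mor L (\<alpha> X)) = ob L (ob R X)"
    using xD(1-4) by (simp add: c)
  moreover have "mor L (\<alpha> X) \<in> Arr A"
    "mor L (mor R x) \<in> Hom A (ob L (ob R X)) (Cod A (mor L (\<alpha> X)))"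
    "mor L e \<in> Hom A (ob L E) (ob L (ob R X))" "ob L E \<in> Obj A"
    using xD(1-4) eD(1-4) by (simp_all add: Hom_iff c)
  moreover have "\<forall>Z \<in> Obj A. \<forall>h \<in> Hom A Z (ob L (ob R X)).
      mor L (\<alpha> X) \<cdot>\<^bsub>A\<^esub> h = mor L (mor R x) \<cdot>\<^bsub>A\<^esub> h \<longrightarrow>
      (\<exists>!k. k \<in> Hom A Z (ob L E) \<and> mor L e \<cdot>\<^bsub>A\<^esub> k = h)"
  proof (intro ballI impI)
    fix Z h assume Z: "Z \<in> Obj A" and "h \<in> Hom A Z (ob L (ob R X))"
      and eq: "mor L (\<alpha> X) \<cdot>\<^bsub>A\<^esub> h = mor L (mor R x) \<cdot>\<^bsub>A\<^esub> h"
    then have h: "h \<in> Arr A" "Dom A h = Z" "Cod A h = ob L (ob R X)"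
      by (simp_all add: Hom_iff)
    show "\<exists>!k. k \<in> Hom A Z (ob L E) \<and> mor L e \<cdot>\<^bsub>A\<^esub> k = h"
      by (rule lift[OF Z h eq])
  qed
  ultimately show ?thesis
    unfolding is_equalizer_def dom by (intro conjI)
qed

text \<open>The arrow \<open>s = \<phi>\<^sub>X\<inverse> \<circ> x\<close> equalizes the image pair; this uses invertibility of \<open>\<phi>\<close> at \<open>G X\<close> as
  well as at \<open>X\<close>. Its factorization through \<open>L e\<close> is the inverse of \<open>\<epsilon>\<^sub>X \<circ> L e\<close>.\<close>

lemma iso_if_L_equalizer:
  assumes x: "is_coalgebra A G \<Delta> \<epsilon>G X x" and e: "is_equalizer B (\<alpha> X) (mor R x) E e"
    and \<phi>_iso: "\<And>X. X \<in> Obj A \<Longrightarrow> is_iso A (\<phi> X)"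
    and Le: "is_equalizer A (mor L (\<alpha> X)) (mor L (mor R x)) (ob L E) (mor L e)"
  shows "is_iso A (\<epsilon> X \<cdot>\<^bsub>A\<^esub> mor L e)"
proof -
  note xD = coalgebraD[OF x] and eD = equalizerD[OF x e]
  note c = arrs \<alpha>_arr
  define p where "p = \<epsilon> X \<cdot>\<^bsub>A\<^esub> mor L e"
  have p: "p \<in> Arr A" "Dom A p = ob L E" "Cod A p = X"
    using xD(1) eD(1-4) by (simp_all add: p_def c)
  have \<phi>e: "\<phi> X \<cdot>\<^bsub>A\<^esub> mor L e = x \<cdot>\<^bsub>A\<^esub> p"
    using equalizing_iff[OF x, of e E] eD(2-5) by (simp add: Hom_iff p_def)
  have GX: "ob G X \<in> Obj A"
    using xD(1) by (simp add: arrs)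
  obtain \<psi> where \<psi>: "\<psi> \<in> Arr A" "Dom A \<psi> = ob G X" "Cod A \<psi> = ob L (ob R X)"
      "\<psi> \<cdot>\<^bsub>A\<^esub> \<phi> X = Ident A (ob L (ob R X))" "\<phi> X \<cdot>\<^bsub>A\<^esub> \<psi> = Ident A (ob G X)"
    using A.is_isoE[OF \<phi>_iso[OF xD(1)] \<phi>.component_Hom[OF xD(1)]] by (auto simp: comp_ftor_def)
  obtain \<chi> where \<chi>: "\<chi> \<in> Arr A" "Dom A \<chi> = ob G (ob G X)" "Cod A \<chi> = ob L (ob R (ob G X))"
      "\<chi> \<cdot>\<^bsub>A\<^esub> \<phi> (ob G X) = Ident A (ob L (ob R (ob G X)))"
    using A.is_isoE[OF \<phi>_iso[OF GX] \<phi>.component_Hom[OF GX]] by (auto simp: comp_ftor_def)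
  define s where "s = \<psi> \<cdot>\<^bsub>A\<^esub> x"
  have s: "s \<in> Arr A" "Dom A s = X" "Cod A s = ob L (ob R X)"
    using \<psi>(1-3) xD(1-4) by (simp_all add: s_def A.Comp_arr)
  have \<phi>s: "\<phi> X \<cdot>\<^bsub>A\<^esub> s = x"
    unfolding s_def using \<psi>(1-3) xD(1-4) by (intro A.Comp_cancel[OF \<psi>(5)]) (simp_all add: c)
  have "\<phi> (ob G X) \<cdot>\<^bsub>A\<^esub> (mor L (\<alpha> X) \<cdot>\<^bsub>A\<^esub> s) = \<Delta> X \<cdot>\<^bsub>A\<^esub> (\<phi> X \<cdot>\<^bsub>A\<^esub> s)"
    using xD(1) s by (intro A.Comp_extend \<phi>_L_\<alpha>) (simp_all add: c)
  also have "\<dots> = mor G x \<cdot>\<^bsub>A\<^esub> (\<phi> X \<cdot>\<^bsub>A\<^esub> s)"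
    unfolding \<phi>s using xD(5) by simp
  also have "\<dots> = \<phi> (ob G X) \<cdot>\<^bsub>A\<^esub> (mor L (mor R x) \<cdot>\<^bsub>A\<^esub> s)"
    using xD(1-4) s by (intro A.Comp_extend \<phi>_nat) (simp_all add: c)
  finally have "\<chi> \<cdot>\<^bsub>A\<^esub> (\<phi> (ob G X) \<cdot>\<^bsub>A\<^esub> (mor L (\<alpha> X) \<cdot>\<^bsub>A\<^esub> s))
      = \<chi> \<cdot>\<^bsub>A\<^esub> (\<phi> (ob G X) \<cdot>\<^bsub>A\<^esub> (mor L (mor R x) \<cdot>\<^bsub>A\<^esub> s))"
    by simp
  moreover have "\<chi> \<cdot>\<^bsub>A\<^esub> (\<phi> (ob G X) \<cdot>\<^bsub>A\<^esub> r) = r" if "r \<in> Arr A" "Cod A r = ob L (ob R (ob G X))" for r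
    using that \<chi>(1-3) GX by (intro A.Comp_cancel[OF \<chi>(4)]) (simp_all add: c)
  ultimately have "mor L (\<alpha> X) \<cdot>\<^bsub>A\<^esub> s = mor L (mor R x) \<cdot>\<^bsub>A\<^esub> s"
    using xD(1-4) s by (simp add: c)
  moreover have "s \<in> Hom A X (Dom A (mor L (\<alpha> X)))"
    using s xD(1) by (simp add: Hom_iff c)
  ultimately obtain v where v: "v \<in> Hom A X (ob L E)" and ev: "mor L e \<cdot>\<^bsub>A\<^esub> v = s"
    using Le xD(1) unfolding is_equalizer_def by blast
  have Le_inj: "k = k'"
    if "mor L e \<cdot>\<^bsub>A\<^esub> k = mor L e \<cdot>\<^bsub>A\<^esub> k'" "k \<in> Hom A Z (ob L E)" "k' \<in> Hom A Z (ob L E)" for k k' Z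
  proof -
    let ?h = "mor L e \<cdot>\<^bsub>A\<^esub> k"
    have "mor L (\<alpha> X) \<cdot>\<^bsub>A\<^esub> ?h = mor L (mor R x) \<cdot>\<^bsub>A\<^esub> ?h"
    proof (rule A.Comp_extend)
      show "mor L (\<alpha> X) \<cdot>\<^bsub>A\<^esub> mor L e = mor L (mor R x) \<cdot>\<^bsub>A\<^esub> mor L e"
        using Le by (simp add: is_equalizer_def)
    qed (use that eD(1-4) xD(1-4) in \<open>simp_all add: Hom_iff c\<close>)
    moreover have "?h \<in> Hom A Z (Dom A (mor L (\<alpha> X)))" "Z \<in> Obj A"
      using that(2) eD(1-4) \<alpha>_arr[OF xD(1)] A.Dom_closed[of k] by (auto simp: Hom_iff L.mor_arr A.Comp_arr)
    ultimately have "\<exists>!k. k \<in> Hom A Z (ob L E) \<and> mor L e \<cdot>\<^bsub>A\<^esub> k = ?h"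
      using Le unfolding is_equalizer_def by blast
    then show ?thesis
      using that by metis
  qed
  have "p \<cdot>\<^bsub>A\<^esub> v = \<epsilon> X \<cdot>\<^bsub>A\<^esub> s"
    unfolding p_def ev[symmetric] using v eD(1-4) xD(1) by (simp add: Hom_iff c)
  also have "\<dots> = \<epsilon>G X \<cdot>\<^bsub>A\<^esub> (\<phi> X \<cdot>\<^bsub>A\<^esub> s)"
    using s xD(1) by (simp add: c flip: \<phi>_counit)
  finally have pv: "p \<cdot>\<^bsub>A\<^esub> v = Ident A X"
    using \<phi>s xD(6) by simp
  have "mor L e \<cdot>\<^bsub>A\<^esub> (v \<cdot>\<^bsub>A\<^esub> p) = s \<cdot>\<^bsub>A\<^esub> p"
    using v p eD(1-4) ev A.Comp_assoc_arr[of p v "mor L e"] by (simp add: Hom_iff L.mor_arr)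
  also have "\<dots> = \<psi> \<cdot>\<^bsub>A\<^esub> (\<phi> X \<cdot>\<^bsub>A\<^esub> mor L e)"
    using \<psi>(1-3) p xD(1-4) by (simp add: s_def \<phi>e c)
  also have "\<dots> = mor L e"
    using \<psi>(1-3) eD(1-4) xD(1) by (intro A.Comp_cancel[OF \<psi>(4)]) (simp_all add: c)
  also have "\<dots> = mor L e \<cdot>\<^bsub>A\<^esub> Ident A (ob L E)"
    using eD(1-4) by (simp add: c)
  finally have "mor L e \<cdot>\<^bsub>A\<^esub> (v \<cdot>\<^bsub>A\<^esub> p) = mor L e \<cdot>\<^bsub>A\<^esub> Ident A (ob L E)" .
  moreover have "v \<cdot>\<^bsub>A\<^esub> p \<in> Hom A (ob L E) (ob L E)"
    using v p by (simp add: Hom_iff A.Comp_arr)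
  moreover have "Ident A (ob L E) \<in> Hom A (ob L E) (ob L E)"
    using eD(1) by (simp add: Hom_iff c)
  ultimately have "v \<cdot>\<^bsub>A\<^esub> p = Ident A (ob L E)"
    by (rule Le_inj)
  moreover have "p \<in> Hom A (ob L E) X"
    using p by (simp add: Hom_iff)
  ultimately show ?thesis
    unfolding p_def[symmetric] using v pv by (blast intro: A.is_isoI)
qed

end


section \<open>The comparison functor\<close>

locale comparison_functor = comonad_comparison +
  K: is_functor B "coalgebras A G \<Delta> \<epsilon>G" K for K +
  assumes K_eq: "ftor_eq B K (comparison_ftor B A L \<eta> \<phi>)"
begin

abbreviation Coalg where "Coalg \<equiv> coalgebras A G \<Delta> \<epsilon>G"

lemma Hom_Coalg:
  "t \<in> Hom Coalg (X, x) (X', x') \<longleftrightarrow>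
    is_coalgebra A G \<Delta> \<epsilon>G X x \<and> is_coalgebra A G \<Delta> \<epsilon>G X' x' \<and>
    (\<exists>f \<in> Hom A X X'. mor G f \<cdot>\<^bsub>A\<^esub> x = x' \<cdot>\<^bsub>A\<^esub> f \<and> t = ((X, x), f, (X', x')))"
  by (auto simp: coalgebras_def Hom_iff[of t])

lemma Obj_Coalg: "(X, x) \<in> Obj Coalg \<longleftrightarrow> is_coalgebra A G \<Delta> \<epsilon>G X x"
  by (simp add: coalgebras_def)

lemma Comp_Coalg: "(S', g, T') \<cdot>\<^bsub>Coalg\<^esub> (S, f, T) = (S, g \<cdot>\<^bsub>A\<^esub> f, T')"
  by (simp add: coalgebras_def)

lemma Ident_Coalg: "Ident Coalg (X, x) = ((X, x), Ident A X, (X, x))"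
  by (simp add: coalgebras_def)

text \<open>The inverse in the underlying category of a coalgebra map is again a coalgebra map, that is,
  the forgetful functor reflects isomorphisms.\<close>

lemma is_iso_Coalg:
  assumes t: "((X, x), f, (X', x')) \<in> Hom Coalg (X, x) (X', x')"
  shows "is_iso Coalg ((X, x), f, (X', x')) \<longleftrightarrow> is_iso A f"
proof
  have f: "f \<in> Hom A X X'"
    using t by (auto simp: Hom_Coalg)
  have x: "is_coalgebra A G \<Delta> \<epsilon>G X x" and x': "is_coalgebra A G \<Delta> \<epsilon>G X' x'"
    and nat: "mor G f \<cdot>\<^bsub>A\<^esub> x = x' \<cdot>\<^bsub>A\<^esub> f"
    using t by (auto simp: Hom_Coalg)
  {
    assume "is_iso Coalg ((X, x), f, (X', x'))"
    then obtain u where u: "u \<in> Hom Coalg (X', x') (X, x)"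
      and inv: "u \<cdot>\<^bsub>Coalg\<^esub> ((X, x), f, (X', x')) = Ident Coalg (X, x)"
        "((X, x), f, (X', x')) \<cdot>\<^bsub>Coalg\<^esub> u = Ident Coalg (X', x')"
      using t unfolding is_iso_def by (auto simp: Hom_iff)
    obtain g where g: "g \<in> Hom A X' X" "u = ((X', x'), g, (X, x))"
      using u by (auto simp: Hom_Coalg)
    have "g \<cdot>\<^bsub>A\<^esub> f = Ident A X" "f \<cdot>\<^bsub>A\<^esub> g = Ident A X'"
      using inv unfolding g(2) by (simp_all add: Comp_Coalg Ident_Coalg)
    then show "is_iso A f"
      using f g(1) by (blast intro: A.is_isoI)
  next
    assume "is_iso A f"
    then obtain g where g: "g \<in> Arr A" "Dom A g = X'" "Cod A g = X"
        and gf: "g \<cdot>\<^bsub>A\<^esub> f = Ident A X" and fg: "f \<cdot>\<^bsub>A\<^esub> g = Ident A X'"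
      using A.is_isoE[OF _ f] by metis
    have f': "f \<in> Arr A" "Dom A f = X" "Cod A f = X'"
      using f by (simp_all add: Hom_iff)
    note xD = coalgebraD[OF x] and x'D = coalgebraD[OF x']
    have "mor G g \<cdot>\<^bsub>A\<^esub> x' = mor G g \<cdot>\<^bsub>A\<^esub> (x' \<cdot>\<^bsub>A\<^esub> (f \<cdot>\<^bsub>A\<^esub> g))"
      unfolding fg using x'D(1-4) by (simp add: A.Comp_id_right)
    also have "x' \<cdot>\<^bsub>A\<^esub> (f \<cdot>\<^bsub>A\<^esub> g) = mor G f \<cdot>\<^bsub>A\<^esub> (x \<cdot>\<^bsub>A\<^esub> g)"
      using f' g xD(1-4) x'D(1-4) by (intro A.Comp_extend nat[symmetric]) (simp_all add: arrs)
    also have "mor G g \<cdot>\<^bsub>A\<^esub> \<dots> = mor G (g \<cdot>\<^bsub>A\<^esub> f) \<cdot>\<^bsub>A\<^esub> (x \<cdot>\<^bsub>A\<^esub> g)"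
      using f' g xD(1-4) by (simp add: arrs)
    also have "\<dots> = x \<cdot>\<^bsub>A\<^esub> g"
      unfolding gf using g xD(1-4) by (simp add: arrs)
    finally have nat': "mor G g \<cdot>\<^bsub>A\<^esub> x' = x \<cdot>\<^bsub>A\<^esub> g" .
    show "is_iso Coalg ((X, x), f, (X', x'))"
    proof (rule K.tgt.is_isoI[OF t])
      show "((X', x'), g, (X, x)) \<in> Hom Coalg (X', x') (X, x)"
        using g nat' x x' by (simp add: Hom_Coalg) (simp add: Hom_iff)
    qed (simp_all add: Comp_Coalg Ident_Coalg gf fg)
  }
qed

lemma ob_K: "Y \<in> Obj B \<Longrightarrow> ob K Y = (ob L Y, \<kappa> Y)"
  using K_eq by (simp add: ftor_eq_def comparison_ftor_def Let_def)

lemma mor_K: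
  assumes "f \<in> Hom B Y Y'"
  shows "mor K f = ((ob L Y, \<kappa> Y), mor L f, (ob L Y', \<kappa> Y'))"
  using K_eq assms by (simp add: ftor_eq_def comparison_ftor_def Let_def Hom_iff)

lemma coalgebra_\<kappa>: "Y \<in> Obj B \<Longrightarrow> is_coalgebra A G \<Delta> \<epsilon>G (ob L Y) (\<kappa> Y)"
  using K.ob_closed[of Y] by (simp add: ob_K Obj_Coalg)

lemma Hom_K:
  assumes "Y \<in> Obj B" and "is_coalgebra A G \<Delta> \<epsilon>G X x"
  shows "t \<in> Hom Coalg (ob K Y) (X, x) \<longleftrightarrow>
    (\<exists>f \<in> Hom A (ob L Y) X. mor G f \<cdot>\<^bsub>A\<^esub> \<kappa> Y = x \<cdot>\<^bsub>A\<^esub> f \<and> t = ((ob L Y, \<kappa> Y), f, (X, x)))"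
  using assms by (simp add: ob_K Hom_Coalg coalgebra_\<kappa>)

lemma cofree_coalgebra:
  assumes "X \<in> Obj A"
  shows "is_coalgebra A G \<Delta> \<epsilon>G (ob G X) (\<Delta> X)"
  using assms comonad.coassoc comonad.counit_left by (simp add: is_coalgebra_def Hom_iff arrs)

text \<open>A coalgebra map \<open>f\<close> into the cofree coalgebra on \<open>X\<close> is determined by \<open>\<epsilon>G\<^sub>X \<circ> f : L Y \<rightarrow> X\<close>, and
  the factorization is the transpose of that arrow.\<close>

lemma \<phi>_couniversal:
  assumes X: "X \<in> Obj A" and Y: "Y \<in> Obj B" and f: "f \<in> Hom A (ob L Y) (ob G X)"
    and coalg: "mor G f \<cdot>\<^bsub>A\<^esub> \<kappa> Y = \<Delta> X \<cdot>\<^bsub>A\<^esub> f"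
  shows "\<exists>!k. k \<in> Hom B Y (ob R X) \<and> \<phi> X \<cdot>\<^bsub>A\<^esub> mor L k = f"
proof -
  have f: "f \<in> Arr A" "Dom A f = ob L Y" "Cod A f = ob G X"
    using f by (simp_all add: Hom_iff)
  define h where "h = \<epsilon>G X \<cdot>\<^bsub>A\<^esub> f"
  have h: "h \<in> Arr A" "Dom A h = ob L Y" "Cod A h = X"
    using f X by (simp_all add: h_def arrs)
  show ?thesis
  proof (rule ex1I[of _ "mor R h \<cdot>\<^bsub>B\<^esub> \<eta> Y"], intro conjI)
    show "mor R h \<cdot>\<^bsub>B\<^esub> \<eta> Y \<in> Hom B Y (ob R X)"
      using h Y by (simp add: Hom_iff arrs)
    have "\<phi> X \<cdot>\<^bsub>A\<^esub> mor L (mor R h \<cdot>\<^bsub>B\<^esub> \<eta> Y) = mor G h \<cdot>\<^bsub>A\<^esub> \<kappa> Y"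
      using G_coaction[OF h Y] by simp
    also have "\<dots> = mor G (\<epsilon>G X) \<cdot>\<^bsub>A\<^esub> (mor G f \<cdot>\<^bsub>A\<^esub> \<kappa> Y)"
      using f X Y by (simp add: h_def arrs)
    also have "\<dots> = f"
      unfolding coalg using f X by (intro A.Comp_cancel[OF comonad.counit_right[OF X]]) (simp_all add: arrs)
    finally show "\<phi> X \<cdot>\<^bsub>A\<^esub> mor L (mor R h \<cdot>\<^bsub>B\<^esub> \<eta> Y) = f" .
  next
    fix k assume k: "k \<in> Hom B Y (ob R X) \<and> \<phi> X \<cdot>\<^bsub>A\<^esub> mor L k = f"
    have k': "k \<in> Arr B" "Dom B k = Y" "Cod B k = ob R X"
      using k by (simp_all add: Hom_iff)
    have "h = (\<epsilon>G X \<cdot>\<^bsub>A\<^esub> \<phi> X) \<cdot>\<^bsub>A\<^esub> mor L k"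
      using k' X k[THEN conjunct2, symmetric] by (simp add: h_def arrs)
    then show "k = mor R h \<cdot>\<^bsub>B\<^esub> \<eta> Y"
      using transpose_counit[OF k' X] \<phi>_counit[OF X] by simp
  qed
qed

lemma equalizer_couniversal:
  assumes x: "is_coalgebra A G \<Delta> \<epsilon>G X x" and e: "is_equalizer B (\<alpha> X) (mor R x) E e"
    and Y: "Y \<in> Obj B" and f: "f \<in> Hom A (ob L Y) X"
    and coalg: "mor G f \<cdot>\<^bsub>A\<^esub> \<kappa> Y = x \<cdot>\<^bsub>A\<^esub> f"
  shows "\<exists>!k. k \<in> Hom B Y E \<and> (\<epsilon> X \<cdot>\<^bsub>A\<^esub> mor L e) \<cdot>\<^bsub>A\<^esub> mor L k = f"
proof -
  note xD = coalgebraD[OF x] and eD = equalizerD[OF x e]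
  have f': "f \<in> Arr A" "Dom A f = ob L Y" "Cod A f = X"
    using f by (simp_all add: Hom_iff)
  define g where "g = mor R f \<cdot>\<^bsub>B\<^esub> \<eta> Y"
  have g: "g \<in> Hom B Y (ob R X)"
    using f' Y by (simp add: g_def Hom_iff arrs)
  have "\<alpha> X \<cdot>\<^bsub>B\<^esub> g = mor R x \<cdot>\<^bsub>B\<^esub> g"
    using coalgebra_map_iff[OF x f Y] coalg by (simp add: g_def)
  then have "\<exists>!k. k \<in> Hom B Y E \<and> e \<cdot>\<^bsub>B\<^esub> k = g"
    by (rule eD(6)[OF Y g])
  moreover have "(\<epsilon> X \<cdot>\<^bsub>A\<^esub> mor L e) \<cdot>\<^bsub>A\<^esub> mor L k = f \<longleftrightarrow> e \<cdot>\<^bsub>B\<^esub> k = g" if k: "k \<in> Hom B Y E" for k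
  proof -
    have ek: "e \<cdot>\<^bsub>B\<^esub> k \<in> Hom B Y (ob R X)"
      using k eD(1-4) by (simp add: Hom_iff arrs)
    have "(\<epsilon> X \<cdot>\<^bsub>A\<^esub> mor L e) \<cdot>\<^bsub>A\<^esub> mor L k = \<epsilon> X \<cdot>\<^bsub>A\<^esub> mor L (e \<cdot>\<^bsub>B\<^esub> k)"
      using k eD(1-4) xD(1) by (simp add: Hom_iff arrs)
    moreover have "\<epsilon> X \<cdot>\<^bsub>A\<^esub> mor L g = f"
      unfolding g_def by (rule counit_transpose[OF f' Y])
    ultimately show ?thesis
      using counit_L_inj[OF ek g xD(1)] by metis
  qed
  ultimately show ?thesis
    by blast
qed

lemma couniversal_coalgebra_map_iso:
  assumes ff: "fully_faithful B Coalg K" and es: "essentially_surjective B Coalg K"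
    and x: "is_coalgebra A G \<Delta> \<epsilon>G X x" and Z: "Z \<in> Obj B"
    and q: "q \<in> Hom A (ob L Z) X" "mor G q \<cdot>\<^bsub>A\<^esub> \<kappa> Z = x \<cdot>\<^bsub>A\<^esub> q"
    and couniversal: "\<And>Y f. Y \<in> Obj B \<Longrightarrow> f \<in> Hom A (ob L Y) X \<Longrightarrow> mor G f \<cdot>\<^bsub>A\<^esub> \<kappa> Y = x \<cdot>\<^bsub>A\<^esub> f
      \<Longrightarrow> \<exists>!k. k \<in> Hom B Y Z \<and> q \<cdot>\<^bsub>A\<^esub> mor L k = f"
  shows "is_iso A q"
proof -
  let ?q = "((ob L Z, \<kappa> Z), q, (X, x))"
  have q_hom: "?q \<in> Hom Coalg (ob K Z) (X, x)"
    using q by (simp add: Hom_K[OF Z x])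
  have "is_iso Coalg ?q"
  proof (rule K.couniversal_iso[OF ff es Z q_hom])
    fix Y s assume Y: "Y \<in> Obj B" and s: "s \<in> Hom Coalg (ob K Y) (X, x)"
    then obtain f where f: "f \<in> Hom A (ob L Y) X" "mor G f \<cdot>\<^bsub>A\<^esub> \<kappa> Y = x \<cdot>\<^bsub>A\<^esub> f"
      and sf: "s = ((ob L Y, \<kappa> Y), f, (X, x))"
      by (auto simp: Hom_K[OF Y x])
    have "?q \<cdot>\<^bsub>Coalg\<^esub> mor K k = s \<longleftrightarrow> q \<cdot>\<^bsub>A\<^esub> mor L k = f" if "k \<in> Hom B Y Z" for k
      by (simp add: mor_K[OF that] sf Comp_Coalg)
    then show "\<exists>!k. k \<in> Hom B Y Z \<and> ?q \<cdot>\<^bsub>Coalg\<^esub> mor K k = s"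
      using couniversal[OF Y f] by blast
  qed
  then show ?thesis
    using is_iso_Coalg[OF q_hom[unfolded ob_K[OF Z]]] by blast
qed

lemma equivalence_imp:
  assumes ff: "fully_faithful B Coalg K" and es: "essentially_surjective B Coalg K"
  shows "X \<in> Obj A \<Longrightarrow> is_iso A (\<phi> X)"
    and "is_coalgebra A G \<Delta> \<epsilon>G X x \<Longrightarrow> preserves_equalizer B A L (\<alpha> X) (mor R x)"
    and "reflects_isos B A L"
proof -
  show \<phi>_iso: "is_iso A (\<phi> X)" if X: "X \<in> Obj A" for X
  proof (rule couniversal_coalgebra_map_iso[OF ff es cofree_coalgebra[OF X] _ _ _ \<phi>_couniversal[OF X]])
    show "ob R X \<in> Obj B" "\<phi> X \<in> Hom A (ob L (ob R X)) (ob G X)"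
      using X by (simp_all add: Hom_iff arrs)
    have "mor G (\<phi> X) \<cdot>\<^bsub>A\<^esub> \<kappa> (ob R X) = \<phi> (ob G X) \<cdot>\<^bsub>A\<^esub> mor L (mor R (\<phi> X) \<cdot>\<^bsub>B\<^esub> \<eta> (ob R X))"
      using X by (intro G_coaction) (simp_all add: arrs)
    then show "mor G (\<phi> X) \<cdot>\<^bsub>A\<^esub> \<kappa> (ob R X) = \<Delta> X \<cdot>\<^bsub>A\<^esub> \<phi> X"
      using \<phi>_L_\<alpha>[OF X] by (simp add: comparison_\<alpha>_def)
  qed
  show "preserves_equalizer B A L (\<alpha> X) (mor R x)" if x: "is_coalgebra A G \<Delta> \<epsilon>G X x"
    unfolding preserves_equalizer_def
  proof (intro allI impI)
    fix E e assume e: "is_equalizer B (\<alpha> X) (mor R x) E e"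
    note xD = coalgebraD[OF x] and eD = equalizerD[OF x e]
    have "is_iso A (\<epsilon> X \<cdot>\<^bsub>A\<^esub> mor L e)"
    proof (rule couniversal_coalgebra_map_iso[OF ff es x eD(1) _ _ equalizer_couniversal[OF x e]])
    qed (fact equalizer_coalgebra_map[OF x e])+
    then show "is_equalizer A (mor L (\<alpha> X)) (mor L (mor R x)) (ob L E) (mor L e)"
      by (rule L_equalizer_if_iso[OF x e \<phi>_iso[OF xD(1)]])
  qed
  show "reflects_isos B A L"
    unfolding reflects_isos_def
  proof (intro ballI impI)
    fix f assume f: "f \<in> Arr B" and "is_iso A (mor L f)"
    have f': "f \<in> Hom B (Dom B f) (Cod B f)"
      using f by (simp add: Hom_iff)
    have obs: "Dom B f \<in> Obj B" "Cod B f \<in> Obj B"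
      using f by (simp_all add: arrs)
    have "mor K f \<in> Hom Coalg (ob K (Dom B f)) (ob K (Cod B f))"
      by (rule K.mor_Hom[OF f'])
    then have "is_iso Coalg (mor K f)"
      using is_iso_Coalg \<open>is_iso A (mor L f)\<close> by (simp add: mor_K[OF f'] ob_K obs)
    then show "is_iso B f"
      using K.fully_faithful_reflects_isos[OF ff] f by (simp add: reflects_isos_def)
  qed
qed

lemma ff_es_if:
  assumes \<phi>_iso: "\<And>X. X \<in> Obj A \<Longrightarrow> is_iso A (\<phi> X)"
    and pres: "\<And>X x. is_coalgebra A G \<Delta> \<epsilon>G X x \<Longrightarrow> preserves_equalizer B A L (\<alpha> X) (mor R x)"
    and refl: "reflects_isos B A L"
    and ex: "\<And>X x. is_coalgebra A G \<Delta> \<epsilon>G X x \<Longrightarrow> \<exists>E e. is_equalizer B (\<alpha> X) (mor R x) E e"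
  shows "fully_faithful B Coalg K" and "essentially_surjective B Coalg K"
proof -
  have p_iso: "is_iso A (\<epsilon> X \<cdot>\<^bsub>A\<^esub> mor L e)"
    if "is_coalgebra A G \<Delta> \<epsilon>G X x" "is_equalizer B (\<alpha> X) (mor R x) E e" for X x E e
    using iso_if_L_equalizer[OF that \<phi>_iso] pres[OF that(1)] that(2) by (simp add: preserves_equalizer_def)
  show "essentially_surjective B Coalg K"
    unfolding essentially_surjective_def
  proof
    fix T assume T: "T \<in> Obj Coalg"
    obtain X x where [simp]: "T = (X, x)"
      by (cases T)
    have x: "is_coalgebra A G \<Delta> \<epsilon>G X x"
      using T by (simp add: Obj_Coalg)
    then obtain E e where e: "is_equalizer B (\<alpha> X) (mor R x) E e"
      using ex by blast
    note eD = equalizerD[OF x e]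
    let ?p = "((ob L E, \<kappa> E), \<epsilon> X \<cdot>\<^bsub>A\<^esub> mor L e, (X, x))"
    have p: "?p \<in> Hom Coalg (ob K E) T"
      using equalizer_coalgebra_map[OF x e] by (simp add: Hom_K[OF eD(1) x])
    then have "is_iso Coalg ?p"
      using is_iso_Coalg[of "ob L E" "\<kappa> E" "\<epsilon> X \<cdot>\<^bsub>A\<^esub> mor L e" X x] p_iso[OF x e] by (simp add: ob_K[OF eD(1)])
    then show "\<exists>Y \<in> Obj B. \<exists>f \<in> Hom Coalg (ob K Y) T. is_iso Coalg f"
      using p eD(1) by blast
  qed
  show "fully_faithful B Coalg K"
    unfolding fully_faithful_def
  proof (intro ballI)
    fix Y Z assume Y: "Y \<in> Obj B" and Z: "Z \<in> Obj B"
    note z = coalgebra_\<kappa>[OF Z]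
    note LZ = L.ob_closed[OF Z]
    obtain E e where e: "is_equalizer B (\<alpha> (ob L Z)) (mor R (\<kappa> Z)) E e"
      using ex[OF z] by blast
    note eD = equalizerD[OF z e]
    let ?p = "\<epsilon> (ob L Z) \<cdot>\<^bsub>A\<^esub> mor L e"
    have id: "Ident A (ob L Z) \<in> Hom A (ob L Z) (ob L Z)"
      "mor G (Ident A (ob L Z)) \<cdot>\<^bsub>A\<^esub> \<kappa> Z = \<kappa> Z \<cdot>\<^bsub>A\<^esub> Ident A (ob L Z)"
      using Z LZ by (simp_all add: Hom_iff arrs)
    obtain u where u: "u \<in> Hom B Z E" and pu: "?p \<cdot>\<^bsub>A\<^esub> mor L u = Ident A (ob L Z)"
      using equalizer_couniversal[OF z e Z id] by blast
    have u': "u \<in> Arr B" "Dom B u = Z" "Cod B u = E"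
      using u by (simp_all add: Hom_iff)
    have p: "?p \<in> Arr A" "Dom A ?p = ob L E" "Cod A ?p = ob L Z"
      using equalizer_coalgebra_map(1)[OF z e] by (simp_all add: Hom_iff)
    obtain q where q: "q \<in> Arr A" "Dom A q = ob L Z" "Cod A q = ob L E"
      "q \<cdot>\<^bsub>A\<^esub> ?p = Ident A (ob L E)" "?p \<cdot>\<^bsub>A\<^esub> q = Ident A (ob L Z)"
      using A.is_isoE[OF p_iso[OF z e] equalizer_coalgebra_map(1)[OF z e]] by blast
    have "mor L u = q \<cdot>\<^bsub>A\<^esub> (?p \<cdot>\<^bsub>A\<^esub> mor L u)"
      using p q(1-3) u' by (intro A.Comp_cancel[OF q(4), symmetric]) (simp_all add: L.mor_arr)
    also have "\<dots> = q"
      unfolding pu using q(1-3) by (simp add: A.Comp_id_right)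
    finally have "mor L u = q" .
    then have "is_iso A (mor L u)"
      using A.is_isoI[of q "ob L Z" "ob L E" ?p] q p equalizer_coalgebra_map(1)[OF z e] by (metis Hom_iff)
    then have "is_iso B u"
      using refl u' by (simp add: reflects_isos_def)
    then obtain w where w: "w \<in> Arr B" "Dom B w = E" "Cod B w = Z"
      and wu: "w \<cdot>\<^bsub>B\<^esub> u = Ident B Z" and uw: "u \<cdot>\<^bsub>B\<^esub> w = Ident B E"
      using B.is_isoE[OF _ u] by metis
    \<comment> \<open>Composition with \<open>u\<close> identifies \<open>L\<close> on arrows \<open>Y \<rightarrow> Z\<close> with the couniversal bijection of
      \<open>?p\<close>.\<close>
    have pL: "?p \<cdot>\<^bsub>A\<^esub> mor L (u \<cdot>\<^bsub>B\<^esub> g) = mor L g" if g: "g \<in> Hom B Y Z" for g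
    proof -
      have g: "g \<in> Arr B" "Dom B g = Y" "Cod B g = Z"
        using g by (simp_all add: Hom_iff)
      have "mor L (u \<cdot>\<^bsub>B\<^esub> g) = mor L u \<cdot>\<^bsub>A\<^esub> mor L g"
        using u' g by (simp add: L.mor_Comp_arr)
      also have "?p \<cdot>\<^bsub>A\<^esub> \<dots> = mor L g"
        using p u' g by (intro A.Comp_cancel[OF pu]) (simp_all add: L.mor_arr)
      finally show ?thesis .
    qed
    have ug: "u \<cdot>\<^bsub>B\<^esub> g \<in> Hom B Y E" if "g \<in> Hom B Y Z" for g
      using u' that by (simp add: Hom_iff B.Comp_arr)
    have wug: "w \<cdot>\<^bsub>B\<^esub> (u \<cdot>\<^bsub>B\<^esub> g) = g" if "g \<in> Hom B Y Z" for g
      using u' w that by (intro B.Comp_cancel[OF wu]) (simp_all add: Hom_iff)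
    have couniv: "\<exists>!k. k \<in> Hom B Y E \<and> ?p \<cdot>\<^bsub>A\<^esub> mor L k = f"
      if "f \<in> Hom A (ob L Y) (ob L Z)" "mor G f \<cdot>\<^bsub>A\<^esub> \<kappa> Y = \<kappa> Z \<cdot>\<^bsub>A\<^esub> f" for f
      by (rule equalizer_couniversal[OF z e Y that])
    have K_hom: "mor L g \<in> Hom A (ob L Y) (ob L Z)" "mor G (mor L g) \<cdot>\<^bsub>A\<^esub> \<kappa> Y = \<kappa> Z \<cdot>\<^bsub>A\<^esub> mor L g"
      if "g \<in> Hom B Y Z" for g
      using K.mor_Hom[OF that] by (auto simp: mor_K[OF that] ob_K[OF Z] Hom_K[OF Y z])
    have inj: "g = g'" if g: "g \<in> Hom B Y Z" and g': "g' \<in> Hom B Y Z" and eq: "mor K g = mor K g'" for g g'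
    proof -
      have "mor L g = mor L g'"
        using eq by (simp add: mor_K[OF g] mor_K[OF g'])
      then have "u \<cdot>\<^bsub>B\<^esub> g = u \<cdot>\<^bsub>B\<^esub> g'"
        using couniv[OF K_hom[OF g]] pL[OF g] pL[OF g'] ug[OF g] ug[OF g'] by metis
      then show ?thesis
        using wug[OF g] wug[OF g'] by metis
    qed
    have surj: "\<exists>g \<in> Hom B Y Z. mor K g = t" if "t \<in> Hom Coalg (ob K Y) (ob K Z)" for t
    proof -
      obtain f where f: "f \<in> Hom A (ob L Y) (ob L Z)" "mor G f \<cdot>\<^bsub>A\<^esub> \<kappa> Y = \<kappa> Z \<cdot>\<^bsub>A\<^esub> f"
        and t: "t = ((ob L Y, \<kappa> Y), f, (ob L Z, \<kappa> Z))"
        using \<open>t \<in> _\<close> by (auto simp: ob_K[OF Z] Hom_K[OF Y z])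
      obtain k where k: "k \<in> Hom B Y E" "?p \<cdot>\<^bsub>A\<^esub> mor L k = f"
        using couniv[OF f] by blast
      have wk: "w \<cdot>\<^bsub>B\<^esub> k \<in> Hom B Y Z"
        using w k(1) by (simp add: Hom_iff B.Comp_arr)
      have "u \<cdot>\<^bsub>B\<^esub> (w \<cdot>\<^bsub>B\<^esub> k) = k"
        using u' w k(1) by (intro B.Comp_cancel[OF uw]) (simp_all add: Hom_iff)
      then have "mor L (w \<cdot>\<^bsub>B\<^esub> k) = f"
        using pL[OF wk] k(2) by simp
      then have "mor K (w \<cdot>\<^bsub>B\<^esub> k) = t"
        by (simp add: mor_K[OF wk] t)
      then show ?thesis
        using wk by blast
    qed
    show "bij_betw (mor K) (Hom B Y Z) (Hom Coalg (ob K Y) (ob K Z))"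
      unfolding bij_betw_def inj_on_def using inj surj K.mor_Hom by blast
  qed
qed

end

theorem mainTheorem6:
  fixes B :: "('p, 'n) category" and A :: "('o, 'm) category"
    and L :: "('p, 'n, 'o, 'm) ftor" and R :: "('o, 'm, 'p, 'n) ftor"
    and \<eta> :: "'p \<Rightarrow> 'n" and \<epsilon> :: "'o \<Rightarrow> 'm"
    and G :: "('o, 'm, 'o, 'm) ftor" and \<Delta> :: "'o \<Rightarrow> 'm" and \<epsilon>G :: "'o \<Rightarrow> 'm"
    and K :: "('p, 'n, 'o \<times> 'm, ('o \<times> 'm) \<times> 'm \<times> ('o \<times> 'm)) ftor"
    and \<phi> :: "'o \<Rightarrow> 'm"
  assumes "adjunction B A L R \<eta> \<epsilon>"
    and "comonad A G \<Delta> \<epsilon>G"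
    and "is_functor B (coalgebras A G \<Delta> \<epsilon>G) K"
    and "ftor_eq B (forgetful \<odot> K) L"
    and "comonad_morphism A (L \<odot> R) (adj_comult L R \<eta>) \<epsilon> G \<Delta> \<epsilon>G \<phi>"
    and "ftor_eq B K (comparison_ftor B A L \<eta> \<phi>)"
    and "\<And>X x. is_coalgebra A G \<Delta> \<epsilon>G X x
      \<Longrightarrow> \<exists>D e. is_equalizer B (comparison_\<alpha> B R \<eta> \<phi> X) (mor R x) D e"
  shows "is_equivalence B (coalgebras A G \<Delta> \<epsilon>G) K \<longleftrightarrow>
    (\<forall>X x. is_coalgebra A G \<Delta> \<epsilon>G X x
      \<longrightarrow> preserves_equalizer B A L (comparison_\<alpha> B R \<eta> \<phi> X) (mor R x)) \<and>
    reflects_isos B A L \<and>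
    is_comonad_iso A (L \<odot> R) (adj_comult L R \<eta>) \<epsilon> G \<Delta> \<epsilon>G \<phi>"
proof -
  interpret adj: adjunction B A L R \<eta> \<epsilon> by fact
  interpret cm: comonad A G \<Delta> \<epsilon>G by fact
  interpret mph: comonad_morphism A "L \<odot> R" "adj_comult L R \<eta>" \<epsilon> G \<Delta> \<epsilon>G \<phi> by fact
  interpret K: is_functor B "coalgebras A G \<Delta> \<epsilon>G" K by fact
  interpret comparison_functor B A L R \<eta> \<epsilon> G \<Delta> \<epsilon>G \<phi> K
    by unfold_locales (use assms(6) in simp_all)
  have iso: "is_comonad_iso A (L \<odot> R) (adj_comult L R \<eta>) \<epsilon> G \<Delta> \<epsilon>G \<phi> \<longleftrightarrow>
      (\<forall>X \<in> Obj A. is_iso A (\<phi> X))"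
    by (rule comonad_iso_iff_components[OF assms(5)])
  have "is_equivalence B (coalgebras A G \<Delta> \<epsilon>G) K \<longleftrightarrow>
      fully_faithful B Coalg K \<and> essentially_surjective B Coalg K"
    using equivalence_imp_ff_es ff_es_imp_equivalence[OF assms(3)] by blast
  then show ?thesis
    unfolding iso using equivalence_imp ff_es_if[OF _ _ _ assms(7)] by blast
qed

end
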